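(* Let $X\subset\mathbb Z^n$ be a finite digital image with $c_1$-adjacency, where $n\le 3$, and let $f,g:X\to X$ be continuous maps that are homotopic. Then $\bar L(f)=\bar L(g)$.
   Context: On $\mathbb Z^n$, the $c_1$-adjacency declares two points adjacent iff they differ by $\pm1$ in exactly one coordinate and agree in all others. Write $x\leftrightarrow y$ for adjacent and $x\Leftrightarrow y$ for adjacent or equal; a map is continuous if $x\leftrightarrow y$ implies $f(x)\Leftrightarrow f(y)$. The digital interval $[0,m]_{\mathbb Z}$ has consecutive integers adjacent. Continuous $f,g:X\to Y$ are homotopic if there exist $m\ge1$ and $H:X\times[0,m]_{\mathbb Z}\to Y$ with $H(\cdot,0)=f$, $H(\cdot,m)=g$, each $t\mapsto H(x,t)$ continuous and each $x\mapsto H(x,t)$ continuous. Cubical homology: an elementary interval is $\{a,a+1\}$ (nondegenerate) or $\{a\}$ (degenerate), $a\in\mathbb Z$; an elementary cube is $\sigma=t_1\times\dots\times t_n$ with each $t_i$ an elementary interval, and its dimension $q$ is the number of nondegenerate factors. $\bar C_q(X)$ is the free abelian group on the elementary $q$-cubes contained in $X$. With $A_i\sigma$ (resp. $B_i\sigma$) obtained by replacing $t_i$ by $\{\min t_i\}$ (resp. $\{\max t_i\}$), and $j_1<\dots<j_q$ the indices of nondegenerate factors, $\partial\sigma=\sum_{i=1}^q(-1)^i(A_{j_i}\sigma-B_{j_i}\sigma)$; $\bar H_q(X)$ is the homology. For continuous $f:X\to Y$ ($Y\subset\mathbb Z^m$ with $c_1$), define $\bar f_q(\sigma)=0$ if $f(\sigma)$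 is not an elementary $q$-cube; otherwise $\tau=f(\sigma)$ is a $q$-cube, and identifying $\sigma$ and $\tau$ with $\{0,1\}^q$ via their nondegenerate coordinates (in increasing order, shifted by their minima), $f|_\sigma$ has the form $(x_1,\dots,x_q)\mapsto(y_1,\dots,y_q)$ with each $y_i\in\{x_{\pi(i)},1-x_{\pi(i)}\}$ for a permutation $\pi$; set $\bar f_q(\sigma)=\operatorname{sgn}(\pi)(-1)^r\tau$, where $r$ is the number of $i$ with $y_i=1-x_{\pi(i)}$. It is known that for $X\subset\mathbb Z^n$ with $n\le4$ these $\bar f_q$ form a chain map, inducing $\bar f_{*,q}:\bar H_q(X)\to\bar H_q(Y)$. For a self-map $f$ of such $X$, the cubical Lefschetz number is $\bar L(f)=\sum_{q\ge0}(-1)^q\operatorname{tr}(\bar f_{*,q})$, traces taken on $\bar H_q(X)\otimes\mathbb Q$. *)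

theory Defs
  imports Complex_Main "HOL-Combinatorics.Permutations"
begin

(* Points of Z^n are int lists of length n. *)

definition c1_adj :: "int list \<Rightarrow> int list \<Rightarrow> bool" where
  "c1_adj x y \<longleftrightarrow> length x = length y \<and>
     (\<exists>i<length x. \<bar>x ! i - y ! i\<bar> = 1 \<and> (\<forall>j<length x. j \<noteq> i \<longrightarrow> x ! j = y ! j))"

definition digi_cont :: "int list set \<Rightarrow> int list set \<Rightarrow> (int list \<Rightarrow> int list) \<Rightarrow> bool" where
  "digi_cont X Y f \<longleftrightarrow> f ` X \<subseteq> Y \<and>
     (\<forall>x\<in>X. \<forall>y\<in>X. c1_adj x y \<longrightarrow> f x = f y \<or> c1_adj (f x) (f y))"

definition digi_homotopic ::
  "int list set \<Rightarrow> int list set \<Rightarrow> (int list \<Rightarrow> int list) \<Rightarrow> (int list \<Rightarrow> int list) \<Rightarrow> bool" where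
  "digi_homotopic X Y f g \<longleftrightarrow>
     (\<exists>m::nat. m \<ge> 1 \<and> (\<exists>H :: int list \<Rightarrow> nat \<Rightarrow> int list.
        (\<forall>x\<in>X. H x 0 = f x \<and> H x m = g x) \<and>
        (\<forall>t\<le>m. digi_cont X Y (\<lambda>x. H x t)) \<and>
        (\<forall>x\<in>X. \<forall>t<m. H x t = H x (t + 1) \<or> c1_adj (H x t) (H x (t + 1)))))"

(* Elementary cubes: one elementary interval per coordinate; (a, False) is {a},
   (a, True) is {a, a+1}. *)
type_synonym cube = "(int \<times> bool) list"

definition cube_set :: "cube \<Rightarrow> int list set" where
  "cube_set \<sigma> = {p. length p = length \<sigma> \<and>
     (\<forall>i<length \<sigma>. p ! i = fst (\<sigma> ! i) \<or> (snd (\<sigma> ! i) \<and> p ! i = fst (\<sigma> ! i) + 1))}"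

(* indices of nondegenerate factors, in increasing order *)
definition ndims :: "cube \<Rightarrow> nat list" where
  "ndims \<sigma> = filter (\<lambda>i. snd (\<sigma> ! i)) [0..<length \<sigma>]"

definition cdim :: "cube \<Rightarrow> nat" where
  "cdim \<sigma> = length (ndims \<sigma>)"

(* elementary q-cubes of Z^n contained in X *)
definition cubes :: "nat \<Rightarrow> nat \<Rightarrow> int list set \<Rightarrow> cube set" where
  "cubes n q X = {\<sigma>. length \<sigma> = n \<and> cdim \<sigma> = q \<and> cube_set \<sigma> \<subseteq> X}"

definition faceA :: "cube \<Rightarrow> nat \<Rightarrow> cube" where
  "faceA \<sigma> j = \<sigma>[j := (fst (\<sigma> ! j), False)]"

definition faceB :: "cube \<Rightarrow> nat \<Rightarrow> cube" where
  "faceB \<sigma> j = \<sigma>[j := (fst (\<sigma> ! j) + 1, False)]"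

(* boundary of an elementary cube, as a rational chain (coefficient function);
   k is 0-based, so the paper's sign (-1)^i is (-1)^(k+1) *)
definition bd_cube :: "cube \<Rightarrow> cube \<Rightarrow> rat" where
  "bd_cube \<sigma> \<tau> = (\<Sum>k<cdim \<sigma>. (-1) ^ (k + 1) *
      ((if \<tau> = faceA \<sigma> (ndims \<sigma> ! k) then 1 else 0)
     - (if \<tau> = faceB \<sigma> (ndims \<sigma> ! k) then 1 else 0)))"

(* rational q-chains of X: finitely supported on the elementary q-cubes in X *)
definition chains :: "nat \<Rightarrow> int list set \<Rightarrow> nat \<Rightarrow> (cube \<Rightarrow> rat) set" where
  "chains n X q = {c. \<forall>\<sigma>. c \<sigma> \<noteq> 0 \<longrightarrow> \<sigma> \<in> cubes n q X}"

definition bd_chain :: "nat \<Rightarrow> int list set \<Rightarrow> nat \<Rightarrow> (cube \<Rightarrow> rat) \<Rightarrow> (cube \<Rightarrow> rat)" where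
  "bd_chain n X q c = (\<lambda>\<tau>. \<Sum>\<sigma>\<in>cubes n q X. c \<sigma> * bd_cube \<sigma> \<tau>)"

(* point of sigma with local coordinates x in {0,1}^q (nondegenerate coordinates
   in increasing order, shifted by their minima) *)
definition cpt :: "cube \<Rightarrow> (nat \<Rightarrow> int) \<Rightarrow> int list" where
  "cpt \<sigma> x = map (\<lambda>i. fst (\<sigma> ! i) +
      (if snd (\<sigma> ! i) then x (card {j. j < i \<and> snd (\<sigma> ! j)}) else 0)) [0..<length \<sigma>]"

(* f restricted to sigma has the form y_i = x_{pi i} or 1 - x_{pi i} (flip e i) *)
definition has_form :: "(int list \<Rightarrow> int list) \<Rightarrow> cube \<Rightarrow> cube \<Rightarrow> (nat \<Rightarrow> nat) \<Rightarrow> (nat \<Rightarrow> bool) \<Rightarrow> bool" where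
  "has_form f \<sigma> \<tau> \<pi> e \<longleftrightarrow> \<pi> permutes {..<cdim \<sigma>} \<and> (\<forall>i\<ge>cdim \<sigma>. \<not> e i) \<and>
     (\<forall>x. (\<forall>i<cdim \<sigma>. x i \<in> {0, 1}) \<longrightarrow>
        f (cpt \<sigma> x) = cpt \<tau> (\<lambda>i. if e i then 1 - x (\<pi> i) else x (\<pi> i)))"

(* coefficient of tau in bar f_q(sigma) *)
definition fcoef :: "(int list \<Rightarrow> int list) \<Rightarrow> cube \<Rightarrow> cube \<Rightarrow> rat" where
  "fcoef f \<sigma> \<tau> =
     (if cdim \<tau> = cdim \<sigma> \<and> f ` cube_set \<sigma> = cube_set \<tau> \<and> (\<exists>\<pi> e. has_form f \<sigma> \<tau> \<pi> e)
      then (let pe = (SOME pe. has_form f \<sigma> \<tau> (fst pe) (snd pe)) in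
            of_int (sign (fst pe)) * (-1) ^ card {i. i < cdim \<sigma> \<and> snd pe i})
      else 0)"

definition chain_map :: "nat \<Rightarrow> int list set \<Rightarrow> (int list \<Rightarrow> int list) \<Rightarrow> nat \<Rightarrow> (cube \<Rightarrow> rat) \<Rightarrow> (cube \<Rightarrow> rat)" where
  "chain_map n X f q c = (\<lambda>\<tau>. \<Sum>\<sigma>\<in>cubes n q X. c \<sigma> * fcoef f \<sigma> \<tau>)"

definition cycles :: "nat \<Rightarrow> int list set \<Rightarrow> nat \<Rightarrow> (cube \<Rightarrow> rat) set" where
  "cycles n X q = {c \<in> chains n X q. bd_chain n X q c = (\<lambda>_. 0)}"

definition bounds :: "nat \<Rightarrow> int list set \<Rightarrow> nat \<Rightarrow> (cube \<Rightarrow> rat) set" where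
  "bounds n X q = bd_chain n X (q + 1) ` chains n X (q + 1)"

(* trace of the map induced by F on the rational vector space Z/B *)
definition lincomb :: "(nat \<Rightarrow> rat) \<Rightarrow> ('c \<Rightarrow> rat) list \<Rightarrow> ('c \<Rightarrow> rat)" where
  "lincomb a zs = (\<lambda>t. \<Sum>i<length zs. a i * (zs ! i) t)"

definition quot_basis :: "('c \<Rightarrow> rat) set \<Rightarrow> ('c \<Rightarrow> rat) set \<Rightarrow> ('c \<Rightarrow> rat) list \<Rightarrow> bool" where
  "quot_basis Z B zs \<longleftrightarrow> set zs \<subseteq> Z \<and>
     (\<forall>z\<in>Z. \<exists>a. (\<lambda>t. z t - lincomb a zs t) \<in> B) \<and>
     (\<forall>a. lincomb a zs \<in> B \<longrightarrow> (\<forall>i<length zs. a i = 0))"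

definition quot_trace :: "('c \<Rightarrow> rat) set \<Rightarrow> ('c \<Rightarrow> rat) set \<Rightarrow> (('c \<Rightarrow> rat) \<Rightarrow> ('c \<Rightarrow> rat)) \<Rightarrow> rat" where
  "quot_trace Z B F = (let zs = (SOME zs. quot_basis Z B zs) in
      \<Sum>i<length zs. (SOME a. (\<lambda>t. F (zs ! i) t - lincomb a zs t) \<in> B) i)"

(* trace of bar f_{*,q} on bar H_q(X) (x) Q *)
definition htrace :: "nat \<Rightarrow> int list set \<Rightarrow> (int list \<Rightarrow> int list) \<Rightarrow> nat \<Rightarrow> rat" where
  "htrace n X f q = quot_trace (cycles n X q) (bounds n X q) (chain_map n X f q)"

(* cubical Lefschetz number; homology vanishes above dimension n *)
definition cub_lefschetz :: "nat \<Rightarrow> int list set \<Rightarrow> (int list \<Rightarrow> int list) \<Rightarrow> rat" where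
  "cub_lefschetz n X f = (\<Sum>q\<le>n. (-1) ^ q * htrace n X f q)"

end

theory Submission
  imports Defs "Jordan_Normal_Form.Determinant"
begin

text \<open>A homotopy step is a continuous map on \<open>X \<times> {0,1}\<close>, and if it induces a chain map, then it gives a
  chain homotopy between the two ends, so that the maps induced on homology agree. It remains to see
  that a continuous \<open>f\<close> induces a chain map, cube by cube. If \<open>f\<close> embeds a \<open>q\<close>-cube, this is a
  computation with signs of permutations. Otherwise \<open>f(\<partial>\<sigma>)\<close> must vanish: by induction on \<open>q\<close> it is a
  cycle, it has at most \<open>2q\<close> cubes, and a nonzero \<open>(q-1)\<close>-cycle of the grid has at least \<open>2q\<close> cubes;
  in the case of equality \<open>f\<close> embeds every face with distinct images, hence embeds \<open>\<sigma>\<close>.\<close>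

section \<open>Linear extension and the boundary\<close>

text \<open>The prism over an image in \<int>^n lies in \<int>^(n+1), while its values stay in
  \<int>^n. So the chain-map property is stated for a function that is continuous on a single cube
  and whose values have one fixed length; this form applies to the prism and passes to faces. The
  obstacle is that a continuous map can collapse a cube in very many ways, and their number explodes
  with the dimension. This is why the argument counts cubes instead of classifying the collapsed
  maps. Embedded cubes are handled like the Laplace expansion of a determinant: passing to a facet
  removes one entry of the permutation, and the sign that appears is that of the cofactor. The trace
  is defined through choices of a basis and of coefficients. Two chain maps that agree modulo
  boundaries satisfy the same conditions on the coefficients in the same chosen basis, so the
  choices return the same number.\<close>

definition supp :: "('a \<Rightarrow> rat) \<Rightarrow> 'a set" where
  "supp z = {x. z x \<noteq> 0}"

text \<open>Summing over the support of \<open>z\<close> itself keeps the ambient image and the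
  degree out of the operators. On chains of a finite image it agrees with \<open>bd_chain\<close>
  and \<open>chain_map\<close>.\<close>

definition lin :: "('a \<Rightarrow> 'b \<Rightarrow> rat) \<Rightarrow> ('a \<Rightarrow> rat) \<Rightarrow> 'b \<Rightarrow> rat" where
  "lin K z = (\<lambda>y. \<Sum>x\<in>supp z. z x * K x y)"

lemma lin_superset:
  assumes "finite S" "supp z \<subseteq> S"
  shows "lin K z y = (\<Sum>x\<in>S. z x * K x y)"
  unfolding lin_def using assms by (intro sum.mono_neutral_left) (auto simp: supp_def)

lemma lin_cong:
  assumes "\<And>x. x \<in> supp z \<Longrightarrow> K x = L x"
  shows "lin K z = lin L z"
  using assms by (auto simp: lin_def intro!: ext sum.cong)

lemma lin_zero [simp]: "lin K (\<lambda>_. 0) = (\<lambda>_. 0)"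
  by (auto simp: lin_def supp_def)

lemma lin_diff:
  assumes "finite (supp z)" "finite (supp w)"
  shows "lin K (\<lambda>x. z x - w x) = (\<lambda>y. lin K z y - lin K w y)"
proof
  fix y
  let ?S = "supp z \<union> supp w"
  have f: "finite ?S" using assms by simp
  have 0: "supp (\<lambda>x. z x - w x) \<subseteq> ?S" by (auto simp: supp_def)
  show "lin K (\<lambda>x. z x - w x) y = lin K z y - lin K w y"
    by (subst (1 2 3) lin_superset[OF f])
       (use 0 in \<open>auto simp: left_diff_distrib sum_subtractf\<close>)
qed

lemma lin_add:
  assumes "finite (supp z)" "finite (supp w)"
  shows "lin K (\<lambda>x. z x + w x) = (\<lambda>y. lin K z y + lin K w y)"
proof
  fix y
  let ?S = "supp z \<union> supp w"
  have f: "finite ?S" using assms by simp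
  have 0: "supp (\<lambda>x. z x + w x) \<subseteq> ?S" by (auto simp: supp_def)
  show "lin K (\<lambda>x. z x + w x) y = lin K z y + lin K w y"
    by (subst (1 2 3) lin_superset[OF f])
       (use 0 in \<open>auto simp: distrib_right sum.distrib\<close>)
qed

lemma supp_minus [simp]: "supp (\<lambda>x. - z x) = supp z"
  by (simp add: supp_def)

lemma lin_minus: "lin K (\<lambda>x. - z x) = (\<lambda>y. - lin K z y)"
  by (simp add: lin_def sum_negf)

lemma supp_lin: "supp (lin K z) \<subseteq> (\<Union>x\<in>supp z. supp (K x))"
proof
  fix y assume "y \<in> supp (lin K z)"
  then have "(\<Sum>x\<in>supp z. z x * K x y) \<noteq> 0" by (simp add: supp_def lin_def)
  then obtain x where "x \<in> supp z" "z x * K x y \<noteq> 0" by (meson sum.neutral)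
  then show "y \<in> (\<Union>x\<in>supp z. supp (K x))" by (auto simp: supp_def)
qed

lemma finite_supp_lin:
  assumes "finite (supp z)" "\<And>x. x \<in> supp z \<Longrightarrow> finite (supp (K x))"
  shows "finite (supp (lin K z))"
  by (rule finite_subset[OF supp_lin]) (use assms in auto)

text \<open>Both sides are one double sum over a common finite set of intermediate cubes, taken in
  either order. This is what carries identities between cubes over to chains.\<close>

lemma lin_lin:
  assumes z: "finite (supp z)" and L: "\<And>x. x \<in> supp z \<Longrightarrow> finite (supp (L x))"
  shows "lin K (lin L z) = lin (\<lambda>x. lin K (L x)) z"
proof
  fix y
  let ?S = "\<Union>x\<in>supp z. supp (L x)"
  have f: "finite ?S" using assms by auto
  have "lin K (lin L z) y = (\<Sum>u\<in>?S. lin L z u * K u y)"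
    by (rule lin_superset[OF f supp_lin])
  also have "\<dots> = (\<Sum>u\<in>?S. \<Sum>x\<in>supp z. z x * L x u * K u y)"
    by (simp add: lin_def sum_distrib_right)
  also have "\<dots> = (\<Sum>x\<in>supp z. \<Sum>u\<in>?S. z x * L x u * K u y)"
    by (rule sum.swap)
  also have "\<dots> = (\<Sum>x\<in>supp z. z x * lin K (L x) y)"
  proof (rule sum.cong[OF refl])
    fix x assume "x \<in> supp z"
    then have "lin K (L x) y = (\<Sum>u\<in>?S. L x u * K u y)" by (intro lin_superset[OF f]) auto
    then show "(\<Sum>u\<in>?S. z x * L x u * K u y) = z x * lin K (L x) y"
      by (simp add: sum_distrib_left mult.assoc)
  qed
  finally show "lin K (lin L z) y = lin (\<lambda>x. lin K (L x)) z y" by (simp add: lin_def)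
qed

lemma supp_indicator [simp]: "supp (\<lambda>y. if y = x then 1 else 0) = {x}"
  by (auto simp: supp_def)

lemma lin_indicator [simp]: "lin K (\<lambda>y. if y = x then 1 else 0) = K x"
  by (simp add: lin_def)

lemma lin_single:
  assumes "supp z \<subseteq> {x}"
  shows "lin K z y = z x * K x y"
  using lin_superset[OF _ assms, of K y] by simp

lemma supp_bd_cube:
  assumes "\<tau> \<in> supp (bd_cube \<sigma>)"
  obtains (face) k where "k < cdim \<sigma>" "\<tau> = faceA \<sigma> (ndims \<sigma> ! k) \<or> \<tau> = faceB \<sigma> (ndims \<sigma> ! k)"
proof (rule ccontr)
  assume "\<not> thesis"
  then have "\<tau> \<noteq> faceA \<sigma> (ndims \<sigma> ! k) \<and> \<tau> \<noteq> faceB \<sigma> (ndims \<sigma> ! k)" if "k < cdim \<sigma>" for k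
    using face that by blast
  then have "bd_cube \<sigma> \<tau> = 0" by (simp add: bd_cube_def)
  then show False using assms by (simp add: supp_def)
qed

lemma finite_supp_bd_cube: "finite (supp (bd_cube \<sigma>))"
  by (rule finite_subset[of _ "\<Union>k<cdim \<sigma>. {faceA \<sigma> (ndims \<sigma> ! k), faceB \<sigma> (ndims \<sigma> ! k)}"])
     (auto elim!: supp_bd_cube)

text \<open>The boundary is expanded into signed indicators before the sum over cubes is taken. Each
  indicator picks out one face, so faces are never compared with each other.\<close>

lemma lin_bd_cube:
  "lin K (bd_cube \<sigma>) y = (\<Sum>k<cdim \<sigma>. (-1) ^ (k + 1) *
     (K (faceA \<sigma> (ndims \<sigma> ! k)) y - K (faceB \<sigma> (ndims \<sigma> ! k)) y))"
proof -
  let ?A = "\<lambda>k. faceA \<sigma> (ndims \<sigma> ! k)" and ?B = "\<lambda>k. faceB \<sigma> (ndims \<sigma> ! k)"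
  define S where "S = (\<Union>k<cdim \<sigma>. {?A k, ?B k})"
  have f: "finite S" by (auto simp: S_def)
  have S: "?A k \<in> S" "?B k \<in> S" if "k < cdim \<sigma>" for k using that by (auto simp: S_def)
  have "supp (bd_cube \<sigma>) \<subseteq> S" by (auto simp: S_def elim!: supp_bd_cube)
  then have "lin K (bd_cube \<sigma>) y = (\<Sum>\<tau>\<in>S. bd_cube \<sigma> \<tau> * K \<tau> y)"
    by (rule lin_superset[OF f])
  also have "\<dots> = (\<Sum>\<tau>\<in>S. \<Sum>k<cdim \<sigma>. (-1) ^ (k + 1) *
      ((if \<tau> = ?A k then K \<tau> y else 0) - (if \<tau> = ?B k then K \<tau> y else 0)))"
    unfolding bd_cube_def sum_distrib_right by (intro sum.cong refl) auto
  also have "\<dots> = (\<Sum>k<cdim \<sigma>. \<Sum>\<tau>\<in>S. (-1) ^ (k + 1) *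
      ((if \<tau> = ?A k then K \<tau> y else 0) - (if \<tau> = ?B k then K \<tau> y else 0)))"
    by (rule sum.swap)
  also have "\<dots> = (\<Sum>k<cdim \<sigma>. (-1) ^ (k + 1) * (K (?A k) y - K (?B k) y))"
    by (intro sum.cong refl)
       (simp add: sum_distrib_left[symmetric] sum_subtractf sum_negf sum.delta[OF f] S del: power_Suc)
  finally show ?thesis .
qed

section \<open>Recursion of the boundary over the first coordinate\<close>

lemma ndims_Cons: "ndims (x # \<sigma>) = (if snd x then [0] else []) @ map Suc (ndims \<sigma>)"
proof -
  have "[0..<length (x # \<sigma>)] = 0 # map Suc [0..<length \<sigma>]"
    by (simp add: map_Suc_upt upt_conv_Cons del: upt_Suc)
  then show ?thesis by (simp add: ndims_def filter_map comp_def)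
qed

lemma bd_cube_Nil: "bd_cube \<sigma> [] = 0"
proof (cases "\<sigma> = []")
  case True
  then show ?thesis by (simp add: bd_cube_def cdim_def ndims_def)
next
  case False
  then have "[] \<noteq> faceA \<sigma> j" "[] \<noteq> faceB \<sigma> j" for j
    by (metis faceA_def list_update_nonempty, metis faceB_def list_update_nonempty)
  then show ?thesis by (simp add: bd_cube_def)
qed

text \<open>The product rule for the first factor. A nondegenerate first factor occupies the first
  position and moves all others up by one, whence the minus sign on the boundary of the remaining
  factors.\<close>

lemma bd_cube_Cons_face:
  "bd_cube ((a, False) # \<sigma>) \<tau> = (if \<tau> \<noteq> [] \<and> hd \<tau> = (a, False) then bd_cube \<sigma> (tl \<tau>) else 0)"
  "bd_cube ((a, True) # \<sigma>) \<tau> = (if \<tau> = (a + 1, False) # \<sigma> then 1 else 0)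
    - (if \<tau> = (a, False) # \<sigma> then 1 else 0)
    - (if \<tau> \<noteq> [] \<and> hd \<tau> = (a, True) then bd_cube \<sigma> (tl \<tau>) else 0)"
proof -
  have c: "\<tau> = faceA (x # \<sigma>) (Suc j) \<longleftrightarrow> \<tau> \<noteq> [] \<and> hd \<tau> = x \<and> tl \<tau> = faceA \<sigma> j"
    "\<tau> = faceB (x # \<sigma>) (Suc j) \<longleftrightarrow> \<tau> \<noteq> [] \<and> hd \<tau> = x \<and> tl \<tau> = faceB \<sigma> j" for x j
    by (cases \<tau>; auto simp: faceA_def faceB_def)+
  show "bd_cube ((a, False) # \<sigma>) \<tau> = (if \<tau> \<noteq> [] \<and> hd \<tau> = (a, False) then bd_cube \<sigma> (tl \<tau>) else 0)"
    by (simp add: bd_cube_def cdim_def ndims_Cons c)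
  have "bd_cube ((a, True) # \<sigma>) \<tau> = (if \<tau> = (a + 1, False) # \<sigma> then 1 else 0)
    - (if \<tau> = (a, False) # \<sigma> then 1 else 0)
    + (\<Sum>k<cdim \<sigma>. (-1) ^ (k + 2) *
      ((if \<tau> \<noteq> [] \<and> hd \<tau> = (a, True) \<and> tl \<tau> = faceA \<sigma> (ndims \<sigma> ! k) then 1 else 0)
     - (if \<tau> \<noteq> [] \<and> hd \<tau> = (a, True) \<and> tl \<tau> = faceB \<sigma> (ndims \<sigma> ! k) then 1 else 0)))"
    unfolding bd_cube_def cdim_def ndims_Cons
    by (simp add: sum.lessThan_Suc_shift c faceA_def[of _ 0] faceB_def[of _ 0] cdim_def
        del: sum.lessThan_Suc)
  then show "bd_cube ((a, True) # \<sigma>) \<tau> = (if \<tau> = (a + 1, False) # \<sigma> then 1 else 0)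
    - (if \<tau> = (a, False) # \<sigma> then 1 else 0)
    - (if \<tau> \<noteq> [] \<and> hd \<tau> = (a, True) then bd_cube \<sigma> (tl \<tau>) else 0)"
    by (simp add: bd_cube_def sum_negf)
qed

text \<open>The product rule read from the target. A cube in the hyperplane at height
  \<open>a\<close> is a face of cubes in that hyperplane, the upper end of a cube in the slab below
  and the lower end of a cube in the slab above.\<close>

lemma bd_cube_Cons_False:
  "bd_cube (x # \<sigma>) ((a, False) # \<tau>) =
    (if x = (a, False) then bd_cube \<sigma> \<tau> else 0)
    + (if x # \<sigma> = (a - 1, True) # \<tau> then 1 else 0) - (if x # \<sigma> = (a, True) # \<tau> then 1 else 0)"
  by (cases x; cases "snd x") (auto simp: bd_cube_Cons_face)

lemma bd_cube_Cons_True: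
  "bd_cube (x # \<sigma>) ((a, True) # \<tau>) = (if x = (a, True) then - bd_cube \<sigma> \<tau> else 0)"
  by (cases x; cases "snd x") (auto simp: bd_cube_Cons_face)

text \<open>The part of a chain over one first factor, seen in one coordinate less:
  \<open>(a, False)\<close> selects a hyperplane and \<open>(a, True)\<close> a unit slab.\<close>

definition slice :: "int \<times> bool \<Rightarrow> (cube \<Rightarrow> rat) \<Rightarrow> cube \<Rightarrow> rat" where
  "slice x z = (\<lambda>\<tau>. z (x # \<tau>))"

lemma Cons_supp_slice: "Cons x ` supp (slice x z) \<subseteq> supp z"
  by (auto simp: supp_def slice_def)

lemma finite_supp_slice: "finite (supp z) \<Longrightarrow> finite (supp (slice x z))"
  using Cons_supp_slice by (metis finite_imageD finite_subset inj_on_Cons1)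

text \<open>The empty list is excluded because \<open>hd []\<close> is arbitrary and might equal
  \<open>x\<close>.\<close>

lemma sum_supp_slice:
  assumes "finite (supp z)" "[] \<notin> supp z"
  shows "(\<Sum>\<rho>\<in>supp z. z \<rho> * (if hd \<rho> = x then G (tl \<rho>) else 0)) =
    (\<Sum>\<rho>\<in>supp (slice x z). slice x z \<rho> * G \<rho>)"
proof -
  have "(\<Sum>\<rho>\<in>supp z. z \<rho> * (if hd \<rho> = x then G (tl \<rho>) else 0)) =
    (\<Sum>\<rho>\<in>Cons x ` supp (slice x z). z \<rho> * (if hd \<rho> = x then G (tl \<rho>) else 0))"
  proof (rule sum.mono_neutral_right[OF assms(1) Cons_supp_slice], rule ballI)
    fix \<rho> assume r: "\<rho> \<in> supp z - Cons x ` supp (slice x z)"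
    then obtain y \<rho>' where "\<rho> = y # \<rho>'" using assms(2) by (cases \<rho>) auto
    then show "z \<rho> * (if hd \<rho> = x then G (tl \<rho>) else 0) = 0"
      using r by (auto simp: supp_def slice_def)
  qed
  also have "\<dots> = (\<Sum>\<rho>\<in>supp (slice x z). slice x z \<rho> * G \<rho>)"
    by (subst sum.reindex) (auto simp: slice_def)
  finally show ?thesis .
qed

text \<open>Across a hyperplane the boundary sees the jump between the two adjacent slabs. Together
  with \<open>lin_bd_slice_True\<close> this writes the boundary as an operator on slices, which
  drives both inductions on the number of coordinates.\<close>

lemma lin_bd_slice_False:
  assumes "finite (supp z)" "[] \<notin> supp z"
  shows "slice (a, False) (lin bd_cube z) = (\<lambda>\<tau>. lin bd_cube (slice (a, False) z) \<tau>
    + slice (a - 1, True) z \<tau> - slice (a, True) z \<tau>)"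
proof
  fix \<tau>
  have d: "(\<Sum>\<rho>\<in>supp z. z \<rho> * (if \<rho> = \<rho>' then 1 else 0)) = z \<rho>'" for \<rho>'
    using assms(1) by (simp add: if_distrib supp_def cong: if_cong)
  have "slice (a, False) (lin bd_cube z) \<tau> = (\<Sum>\<rho>\<in>supp z. z \<rho> * bd_cube \<rho> ((a, False) # \<tau>))"
    by (simp add: slice_def lin_def)
  also have "\<dots> = (\<Sum>\<rho>\<in>supp z. z \<rho> * (if hd \<rho> = (a, False) then bd_cube (tl \<rho>) \<tau> else 0)
      + z \<rho> * (if \<rho> = (a - 1, True) # \<tau> then 1 else 0) - z \<rho> * (if \<rho> = (a, True) # \<tau> then 1 else 0))"
  proof (rule sum.cong[OF refl])
    fix \<rho> assume "\<rho> \<in> supp z"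
    then obtain y \<rho>' where r: "\<rho> = y # \<rho>'" using assms(2) by (cases \<rho>) auto
    show "z \<rho> * bd_cube \<rho> ((a, False) # \<tau>) = z \<rho> * (if hd \<rho> = (a, False) then bd_cube (tl \<rho>) \<tau> else 0)
      + z \<rho> * (if \<rho> = (a - 1, True) # \<tau> then 1 else 0) - z \<rho> * (if \<rho> = (a, True) # \<tau> then 1 else 0)"
      unfolding r bd_cube_Cons_False list.sel by (simp add: algebra_simps)
  qed
  also have "\<dots> = lin bd_cube (slice (a, False) z) \<tau> + slice (a - 1, True) z \<tau> - slice (a, True) z \<tau>"
    unfolding sum.distrib sum_subtractf d sum_supp_slice[OF assms, of "(a,False)" "\<lambda>\<rho>. bd_cube \<rho> \<tau>"]
    by (simp add: lin_def slice_def)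
  finally show "slice (a, False) (lin bd_cube z) \<tau> = lin bd_cube (slice (a, False) z) \<tau>
    + slice (a - 1, True) z \<tau> - slice (a, True) z \<tau>" .
qed

lemma lin_bd_slice_True:
  assumes "finite (supp z)" "[] \<notin> supp z"
  shows "slice (a, True) (lin bd_cube z) = (\<lambda>\<tau>. - lin bd_cube (slice (a, True) z) \<tau>)"
proof
  fix \<tau>
  have "slice (a, True) (lin bd_cube z) \<tau> = (\<Sum>\<rho>\<in>supp z. z \<rho> * bd_cube \<rho> ((a, True) # \<tau>))"
    by (simp add: slice_def lin_def)
  also have "\<dots> = (\<Sum>\<rho>\<in>supp z. z \<rho> * (if hd \<rho> = (a, True) then - bd_cube (tl \<rho>) \<tau> else 0))"
  proof (rule sum.cong[OF refl])
    fix \<rho> assume "\<rho> \<in> supp z"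
    then obtain y \<rho>' where r: "\<rho> = y # \<rho>'" using assms(2) by (cases \<rho>) auto
    show "z \<rho> * bd_cube \<rho> ((a, True) # \<tau>) =
      z \<rho> * (if hd \<rho> = (a, True) then - bd_cube (tl \<rho>) \<tau> else 0)"
      unfolding r bd_cube_Cons_True by simp
  qed
  also have "\<dots> = - lin bd_cube (slice (a, True) z) \<tau>"
    unfolding sum_supp_slice[OF assms, of "(a,True)" "\<lambda>\<rho>. - bd_cube \<rho> \<tau>"]
    by (simp add: lin_def sum_negf)
  finally show "slice (a, True) (lin bd_cube z) \<tau> = - lin bd_cube (slice (a, True) z) \<tau>" .
qed

lemma finite_supp_lin_bd: "finite (supp z) \<Longrightarrow> finite (supp (lin bd_cube z))"
  by (rule finite_supp_lin) (auto intro: finite_supp_bd_cube)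

lemma finite_supp_add: "finite (supp z) \<Longrightarrow> finite (supp w) \<Longrightarrow> finite (supp (\<lambda>x. z x + w x))"
  by (rule finite_subset[of _ "supp z \<union> supp w"]) (auto simp: supp_def)

lemma supp_lin_bd_length:
  assumes "\<And>\<sigma>. \<sigma> \<in> supp z \<Longrightarrow> length \<sigma> = n" "\<tau> \<in> supp (lin bd_cube z)"
  shows "length \<tau> = n"
proof -
  obtain \<sigma> where s: "\<sigma> \<in> supp z" "\<tau> \<in> supp (bd_cube \<sigma>)" using supp_lin assms(2) by fastforce
  then show ?thesis using assms(1)[OF s(1)] by (auto simp: faceA_def faceB_def elim!: supp_bd_cube)
qed

text \<open>Instead of pairing off faces of codimension two, the induction removes the first
  coordinate. In a hyperplane the boundaries of the adjacent slabs occur twice: once from the jump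
  term, once with the opposite sign from \<open>lin_bd_slice_True\<close>. Only the double boundary
  of the slice remains.\<close>

lemma lin_bd_bd:
  assumes "finite (supp z)" "\<And>\<sigma>. \<sigma> \<in> supp z \<Longrightarrow> length \<sigma> = n"
  shows "lin bd_cube (lin bd_cube z) = (\<lambda>_. 0)"
  using assms
proof (induction n arbitrary: z)
  case 0
  have "lin bd_cube z = (\<lambda>_. 0)" if "\<And>\<sigma>. \<sigma> \<in> supp z \<Longrightarrow> \<sigma> = []" for z
    using that by (force simp: lin_def bd_cube_def cdim_def ndims_def)
  then show ?case using 0 by auto
next
  case (Suc n)
  let ?Z = "lin bd_cube z"
  note fz = \<open>finite (supp z)\<close>
  have fZ: "finite (supp ?Z)" using fz by (rule finite_supp_lin_bd)
  have nz: "[] \<notin> supp z" using Suc.prems(2) by force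
  have nZ: "[] \<notin> supp ?Z" using supp_lin_bd_length[of z "Suc n"] Suc.prems(2) by force
  have IH: "lin bd_cube (lin bd_cube (slice x z)) = (\<lambda>_. 0)" for x
  proof (rule Suc.IH[OF finite_supp_slice[OF fz]])
    fix \<sigma> assume "\<sigma> \<in> supp (slice x z)"
    then show "length \<sigma> = n" using Suc.prems(2)[of "x # \<sigma>"] by (simp add: supp_def slice_def)
  qed
  note fs = finite_supp_slice[OF fz]
  show ?case
  proof
    fix \<tau>
    show "lin bd_cube ?Z \<tau> = 0"
    proof (cases \<tau>)
      case Nil
      then show ?thesis by (simp add: lin_def bd_cube_Nil)
    next
      case (Cons x \<tau>')
      obtain a b where x: "x = (a, b)" by force
      have e: "lin bd_cube ?Z \<tau> = slice (a, b) (lin bd_cube ?Z) \<tau>'" by (simp add: Cons x slice_def)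
      show ?thesis
      proof (cases b)
        case True
        then show ?thesis
          unfolding e by (simp add: lin_bd_slice_True[OF fZ nZ] lin_bd_slice_True[OF fz nz] lin_minus IH)
      next
        case False
        have "slice (a, False) (lin bd_cube ?Z) \<tau>' = 0"
          unfolding lin_bd_slice_False[OF fZ nZ] lin_bd_slice_True[OF fz nz] lin_bd_slice_False[OF fz nz]
          by (subst lin_diff lin_add; (intro fs finite_supp_add finite_supp_lin_bd)?)+ (simp add: IH)
        then show ?thesis unfolding e using False by simp
      qed
    qed
  qed
qed

section \<open>The smallest cycles of the grid\<close>

text \<open>The augmentation. Every 0-chain is a cycle, so in degree 0 the lower bound on the size
  of a cycle holds only for coefficient sum 0.\<close>

definition aug :: "('a \<Rightarrow> rat) \<Rightarrow> rat" where
  "aug z = (\<Sum>x\<in>supp z. z x)"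

lemma aug_lin_bd:
  assumes "finite (supp z)"
  shows "aug (lin bd_cube z) = 0"
proof -
  \<comment> \<open>Adding up coefficients is the linear extension of a map into a one-point type.
    So \<open>lin_lin\<close> reduces the claim to a single cube, where opposite faces
    cancel.\<close>
  have "aug (lin bd_cube z) = lin (\<lambda>_ _. 1) (lin bd_cube z) ()" by (simp add: aug_def lin_def)
  also have "\<dots> = lin (\<lambda>x. lin (\<lambda>_ _. 1) (bd_cube x)) z ()"
    using assms by (simp add: lin_lin finite_supp_bd_cube)
  also have "\<dots> = 0" by (simp add: lin_def[of _ z] lin_bd_cube)
  finally show ?thesis .
qed

lemma cdim_Cons: "cdim (x # \<sigma>) = (if snd x then Suc (cdim \<sigma>) else cdim \<sigma>)"
  by (simp add: cdim_def ndims_Cons)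

text \<open>Slicing by the first coordinate: a nonzero slice across the slab \<open>[a, a+1]\<close> is a cycle of one
  dimension less, and the extremal slices must be capped off above and below.\<close>

lemma cycle_card_supp:
  assumes "finite (supp z)" "\<And>\<sigma>. \<sigma> \<in> supp z \<Longrightarrow> length \<sigma> = n \<and> cdim \<sigma> = k"
    and "lin bd_cube z = (\<lambda>_. 0)" "k = 0 \<Longrightarrow> aug z = 0" "supp z \<noteq> {}"
  shows "2 * (k + 1) \<le> card (supp z)"
  using assms
proof (induction n arbitrary: k z)
  case 0
  then have s: "supp z \<subseteq> {[]}" by auto
  then have "k = 0" "supp z = {[]}" using 0 by (force simp: cdim_def ndims_def)+
  then have "z [] = 0" using 0(4) by (simp add: aug_def)
  then show ?case using \<open>supp z = {[]}\<close> by (auto simp: supp_def)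
next
  case (Suc n)
  note fz = Suc.prems(1)
  have nz: "[] \<notin> supp z" using Suc.prems(2) by force
  note fs = finite_supp_slice[OF fz]
  have z0: "slice x (lin bd_cube z) \<tau> = 0" for x \<tau> using Suc.prems(3) by (simp add: slice_def)
  have F: "lin bd_cube (slice (a, False) z) \<tau> + slice (a - 1, True) z \<tau> - slice (a, True) z \<tau> = 0" for a \<tau>
    using z0[of "(a,False)" \<tau>] lin_bd_slice_False[OF fz nz, of a] by simp
  have T: "lin bd_cube (slice (a, True) z) = (\<lambda>_. 0)" for a
    using z0[of "(a,True)"] lin_bd_slice_True[OF fz nz, of a] by (auto simp: fun_eq_iff)
  have s: "length \<tau> = n \<and> cdim (x # \<tau>) = k" if "\<tau> \<in> supp (slice x z)" for x \<tau>
    using Suc.prems(2)[of "x # \<tau>"] that by (simp add: supp_def slice_def)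
  consider "k = 0" | "k > 0" "\<forall>a. supp (slice (a, True) z) = {}" | "\<exists>a. supp (slice (a, True) z) \<noteq> {}"
    by blast
  then show ?case
  proof cases
    \<comment> \<open>A support with a single cube would have a nonzero coefficient sum.\<close>
    case 1
    show ?thesis
    proof (rule ccontr)
      assume "\<not> ?thesis"
      then have "card (supp z) = 1" using 1 Suc.prems(5) fz
        by (metis One_nat_def card_0_eq add_0 less_2_cases linorder_not_less mult.right_neutral)
      then obtain \<sigma> where "supp z = {\<sigma>}" by (rule card_1_singletonE)
      then show False using Suc.prems(4)[OF 1] by (auto simp: aug_def supp_def)
    qed
  next
    \<comment> \<open>Without slabs the boundary relation decouples: each hyperplane slice is a
      cycle of the same dimension, and one nonzero slice is enough.\<close>
    case 2
    then have e: "slice (a, True) z \<tau> = 0" for a \<tau> by (auto simp: supp_def)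
    obtain \<sigma> where sg: "\<sigma> \<in> supp z" using Suc.prems(5) by blast
    then obtain a b \<tau> where st: "\<sigma> = (a, b) # \<tau>" using nz by (cases \<sigma>) auto
    have "\<not> b" using e[of a \<tau>] sg by (auto simp: st slice_def supp_def)
    then have ne: "supp (slice (a, False) z) \<noteq> {}" using sg by (auto simp: st slice_def supp_def)
    have "2 * (k + 1) \<le> card (supp (slice (a, False) z))"
    proof (rule Suc.IH[OF fs _ _ _ ne])
      show "lin bd_cube (slice (a, False) z) = (\<lambda>_. 0)" using F[of a] e by auto
      show "k = 0 \<Longrightarrow> aug (slice (a, False) z) = 0" using 2 by simp
      show "\<And>\<sigma>. \<sigma> \<in> supp (slice (a, False) z) \<Longrightarrow> length \<sigma> = n \<and> cdim \<sigma> = k"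
        using s[of _ "(a,False)"] by (auto simp: cdim_Cons)
    qed
    also have "\<dots> = card (Cons (a, False) ` supp (slice (a, False) z))" by (simp add: card_image)
    also have "\<dots> \<le> card (supp z)" by (rule card_mono[OF fz Cons_supp_slice])
    finally show ?thesis .
  next
    case 3
    define I where "I = {a. supp (slice (a, True) z) \<noteq> {}}"
    have "I \<subseteq> (\<lambda>\<sigma>. fst (hd \<sigma>)) ` supp z"
      by (force simp: I_def supp_def slice_def image_iff)
    then have fI: "finite I" using fz finite_surj by blast
    have nI: "I \<noteq> {}" using 3 by (auto simp: I_def)
    define a where "a = Max I"
    define b where "b = Min I"
    have aI: "a \<in> I" and bI: "b \<in> I" and ba: "b \<le> a" using fI nI by (auto simp: a_def b_def)
    have "a + 1 \<notin> I" "b - 1 \<notin> I"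
      using fI Max_ge[of I "a+1"] Min_le[of I "b-1"] by (auto simp: a_def b_def)
    then have e: "slice (a + 1, True) z \<tau> = 0" "slice (b - 1, True) z \<tau> = 0" for \<tau>
      by (auto simp: I_def supp_def)
    let ?w = "slice (a, True) z"
    \<comment> \<open>No slab lies above the topmost one, so the boundary relation at height
      \<open>a + 1\<close> makes this slab, up to sign, the boundary of the hyperplane slice there.
      Hence that slice is nonzero, and the slab has augmentation 0, as the induction hypothesis
      demands when \<open>k = 1\<close>.\<close>
    have w: "?w = (\<lambda>\<tau>. - lin bd_cube (slice (a + 1, False) z) \<tau>)"
      using F[of "a+1"] e by (auto simp: fun_eq_iff eq_neg_iff_add_eq_0 add.commute)
    have wb: "slice (b, True) z = lin bd_cube (slice (b, False) z)"
      using F[of "b"] e by (auto simp: fun_eq_iff)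
    have aw: "aug ?w = 0"
      using aug_lin_bd[OF fs] by (simp add: w aug_def sum_negf)
    have k: "k > 0" using aI s[of _ "(a,True)"] by (fastforce simp: I_def cdim_Cons)
    have ne: "supp ?w \<noteq> {}" using aI by (simp add: I_def)
    have "2 * (k - 1 + 1) \<le> card (supp ?w)"
      by (rule Suc.IH[OF fs _ T aw ne]) (use s[of _ "(a,True)"] in \<open>fastforce simp: cdim_Cons\<close>)+
    then have c: "2 * k \<le> card (Cons (a, True) ` supp ?w)" using k by (simp add: card_image)
    have "supp (slice (a + 1, False) z) \<noteq> {}"
    proof
      assume "supp (slice (a + 1, False) z) = {}"
      then have "?w = (\<lambda>_. 0)" unfolding w by (simp add: lin_def)
      then show False using ne by (simp add: supp_def)
    qed
    then obtain \<tau>1 where t1: "(a + 1, False) # \<tau>1 \<in> supp z" by (auto simp: supp_def slice_def)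
    have "supp (slice (b, False) z) \<noteq> {}"
    proof
      assume "supp (slice (b, False) z) = {}"
      then have "slice (b, True) z = (\<lambda>_. 0)" unfolding wb by (simp add: lin_def)
      then show False using bI by (simp add: supp_def I_def)
    qed
    then obtain \<tau>2 where t2: "(b, False) # \<tau>2 \<in> supp z" by (auto simp: supp_def slice_def)
    let ?C = "Cons (a, True) ` supp ?w"
    \<comment> \<open>To the \<open>2 * k\<close> cubes of the slab come one cap at height
      \<open>a + 1\<close> and one at height \<open>b\<close>. They are distinct because
      \<open>b \<le> a\<close>, and degenerate in the first factor, unlike the cubes of the
      slab.\<close>
    have "card (insert ((a + 1, False) # \<tau>1) (insert ((b, False) # \<tau>2) ?C)) = card ?C + 2"
      using fs ba by (subst card_insert_disjoint; (subst card_insert_disjoint)?) auto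
    moreover have "card (insert ((a + 1, False) # \<tau>1) (insert ((b, False) # \<tau>2) ?C)) \<le> card (supp z)"
      by (rule card_mono[OF fz]) (use t1 t2 Cons_supp_slice[of "(a,True)" z] in auto)
    ultimately show ?thesis using c by simp
  qed
qed

section \<open>Embedded cubes\<close>

text \<open>The number of the local coordinate that belongs to position \<open>i\<close>, in the
  form in which \<open>cpt\<close> counts it. On nondegenerate positions it is inverse to indexing
  into \<open>ndims \<sigma>\<close>.\<close>

definition rk :: "cube \<Rightarrow> nat \<Rightarrow> nat" where
  "rk \<sigma> i = card {j. j < i \<and> snd (\<sigma> ! j)}"

lemma set_ndims: "set (ndims \<sigma>) = {j. j < length \<sigma> \<and> snd (\<sigma> ! j)}"
  by (auto simp: ndims_def)

lemma cdim_card: "cdim \<sigma> = card {j. j < length \<sigma> \<and> snd (\<sigma> ! j)}"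
  unfolding cdim_def set_ndims[symmetric] by (rule distinct_card[symmetric]) (simp add: ndims_def)

lemma rk_less:
  assumes "i < j" "snd (\<sigma> ! i)"
  shows "rk \<sigma> i < rk \<sigma> j"
  unfolding rk_def using assms by (intro psubset_card_mono) auto

lemma rk_less_cdim:
  assumes "i < length \<sigma>" "snd (\<sigma> ! i)"
  shows "rk \<sigma> i < cdim \<sigma>"
  using rk_less[OF assms] by (simp add: rk_def cdim_card)

lemma bij_betw_rk: "bij_betw (rk \<sigma>) {j. j < length \<sigma> \<and> snd (\<sigma> ! j)} {..<cdim \<sigma>}"
proof -
  let ?J = "{j. j < length \<sigma> \<and> snd (\<sigma> ! j)}"
  have inj: "inj_on (rk \<sigma>) ?J"
    by (rule linorder_inj_onI') (use rk_less in fastforce)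
  have "rk \<sigma> ` ?J \<subseteq> {..<cdim \<sigma>}" using rk_less_cdim by auto
  then have "rk \<sigma> ` ?J = {..<cdim \<sigma>}"
    by (rule card_subset_eq[rotated]) (simp_all add: card_image[OF inj] cdim_card)
  then show ?thesis using inj by (simp add: bij_betw_def)
qed

lemma rk_Cons_Suc: "rk (x # \<sigma>) (Suc i) = (if snd x then Suc (rk \<sigma> i) else rk \<sigma> i)"
proof -
  have "{j. j < Suc i \<and> snd ((x # \<sigma>) ! j)} =
      (if snd x then {0} else {}) \<union> Suc ` {j. j < i \<and> snd (\<sigma> ! j)}"
    by (auto simp: image_iff less_Suc_eq_0_disj)
  then show ?thesis unfolding rk_def
    by (auto simp: card_image card_insert_if)
qed

lemma ndims_nth:
  assumes "k < cdim \<sigma>"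
  shows "ndims \<sigma> ! k < length \<sigma>" "snd (\<sigma> ! (ndims \<sigma> ! k))"
  using nth_mem[of k "ndims \<sigma>"] assms by (auto simp: set_ndims cdim_def simp del: nth_mem)

lemma rk_ndims_nth: "k < cdim \<sigma> \<Longrightarrow> rk \<sigma> (ndims \<sigma> ! k) = k"
proof (induction \<sigma> arbitrary: k)
  case Nil
  then show ?case by (simp add: cdim_def ndims_def)
next
  case (Cons x \<sigma>)
  show ?case
  proof (cases "snd x \<and> k = 0")
    case True
    then show ?thesis by (simp add: ndims_Cons rk_def)
  next
    case False
    then show ?thesis using Cons
      by (cases k) (auto simp: cdim_Cons ndims_Cons rk_Cons_Suc cdim_def split: if_splits)
  qed
qed

lemma ndims_nth_rk:
  assumes "i < length \<sigma>" "snd (\<sigma> ! i)"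
  shows "ndims \<sigma> ! rk \<sigma> i = i"
proof -
  have "rk \<sigma> i < cdim \<sigma>" using rk_less_cdim[OF assms] .
  then show ?thesis
    using bij_betw_rk[of \<sigma>] assms ndims_nth rk_ndims_nth by (fastforce simp: bij_betw_def inj_on_def)
qed

lemma length_cpt [simp]: "length (cpt \<sigma> x) = length \<sigma>"
  by (simp add: cpt_def)

lemma nth_cpt: "i < length \<sigma> \<Longrightarrow> cpt \<sigma> x ! i = fst (\<sigma> ! i) + (if snd (\<sigma> ! i) then x (rk \<sigma> i) else 0)"
  by (simp add: cpt_def rk_def)

lemma cpt_in_cube_set:
  assumes "\<forall>i<cdim \<sigma>. x i \<in> {0, 1}"
  shows "cpt \<sigma> x \<in> cube_set \<sigma>"
  using assms rk_less_cdim by (force simp: cube_set_def nth_cpt)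

lemma cpt_cong:
  assumes "\<And>i. i < cdim \<sigma> \<Longrightarrow> x i = y i"
  shows "cpt \<sigma> x = cpt \<sigma> y"
  using assms rk_less_cdim by (auto intro!: nth_equalityI simp: nth_cpt)

lemma cpt_inj:
  assumes "cpt \<sigma> x = cpt \<sigma> y" "i < cdim \<sigma>"
  shows "x i = y i"
proof -
  have "cpt \<sigma> x ! (ndims \<sigma> ! i) = cpt \<sigma> y ! (ndims \<sigma> ! i)" using assms by simp
  then show ?thesis using ndims_nth[OF assms(2)] by (simp add: nth_cpt rk_ndims_nth[OF assms(2)])
qed

lemma cube_setE:
  assumes "p \<in> cube_set \<sigma>"
  obtains x where "\<forall>i. x i \<in> {0, 1}" "p = cpt \<sigma> x"
proof
  \<comment> \<open>Local coordinates beyond the dimension are set to 0, so that the 0/1 condition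
    can be imposed on all indices.\<close>
  let ?x = "\<lambda>i. if i < cdim \<sigma> then p ! (ndims \<sigma> ! i) - fst (\<sigma> ! (ndims \<sigma> ! i)) else 0"
  show "\<forall>i. ?x i \<in> {0, 1}"
  proof
    fix i
    show "?x i \<in> {0, 1}" using ndims_nth[of i \<sigma>] assms by (auto simp: cube_set_def)
  qed
  show "p = cpt \<sigma> ?x"
    using assms by (intro nth_equalityI) (auto simp: cube_set_def nth_cpt ndims_nth_rk rk_less_cdim)
qed

lemma cube_set_eq: "cube_set \<sigma> = cpt \<sigma> ` {x. \<forall>i. x i \<in> {0, 1}}"
  using cpt_in_cube_set by (blast elim: cube_setE)

text \<open>The lowest and the highest corner of each cube are tested for membership in the other;
  they determine the minimum and the width of every factor.\<close>

lemma cube_set_inj: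
  assumes "cube_set \<sigma> = cube_set \<tau>"
  shows "\<sigma> = \<tau>"
proof -
  have m: "map fst \<sigma> \<in> cube_set \<sigma>" for \<sigma> :: cube by (auto simp: cube_set_def)
  have M: "map (\<lambda>t. fst t + (if snd t then 1 else 0)) \<sigma> \<in> cube_set \<sigma>" for \<sigma> :: cube
    by (auto simp: cube_set_def)
  have l: "length \<sigma> = length \<tau>" using m[of \<sigma>] unfolding assms by (simp add: cube_set_def)
  show ?thesis
  proof (rule nth_equalityI[OF l])
    fix i assume i: "i < length \<sigma>"
    then have i': "i < length \<tau>" using l by simp
    have a: "fst (\<sigma> ! i) = fst (\<tau> ! i) \<or> (snd (\<tau> ! i) \<and> fst (\<sigma> ! i) = fst (\<tau> ! i) + 1)"
      using m[of \<sigma>] i i' unfolding assms by (auto simp: cube_set_def)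
    have b: "fst (\<tau> ! i) = fst (\<sigma> ! i) \<or> (snd (\<sigma> ! i) \<and> fst (\<tau> ! i) = fst (\<sigma> ! i) + 1)"
      using m[of \<tau>] i i' unfolding assms[symmetric] by (auto simp: cube_set_def)
    have e: "fst (\<sigma> ! i) = fst (\<tau> ! i)" using a b by linarith
    have "snd (\<sigma> ! i) \<longrightarrow> snd (\<tau> ! i)"
      using M[of \<sigma>] i i' e unfolding assms by (auto simp: cube_set_def)
    moreover have "snd (\<tau> ! i) \<longrightarrow> snd (\<sigma> ! i)"
      using M[of \<tau>] i i' e unfolding assms[symmetric] by (auto simp: cube_set_def)
    ultimately show "\<sigma> ! i = \<tau> ! i" using e by (auto simp: prod_eq_iff)
  qed
qed

text \<open>Lower and upper faces are indexed uniformly by \<open>c\<close> equal to 0 or 1, and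
  \<open>k\<close> counts nondegenerate factors. A flip then exchanges the two faces by
  \<open>c \<mapsto> 1 - c\<close>.\<close>

definition face :: "cube \<Rightarrow> nat \<Rightarrow> int \<Rightarrow> cube" where
  "face \<sigma> k c = \<sigma>[ndims \<sigma> ! k := (fst (\<sigma> ! (ndims \<sigma> ! k)) + c, False)]"

lemma faceA_face: "faceA \<sigma> (ndims \<sigma> ! k) = face \<sigma> k 0"
  and faceB_face: "faceB \<sigma> (ndims \<sigma> ! k) = face \<sigma> k 1"
  by (simp_all add: faceA_def faceB_def face_def)

lemma length_face [simp]: "length (face \<sigma> k c) = length \<sigma>"
  by (simp add: face_def)

lemma cdim_face:
  assumes "k < cdim \<sigma>"
  shows "cdim (face \<sigma> k c) = cdim \<sigma> - 1"
proof -
  have "{j. j < length (face \<sigma> k c) \<and> snd (face \<sigma> k c ! j)} =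
      {j. j < length \<sigma> \<and> snd (\<sigma> ! j)} - {ndims \<sigma> ! k}"
    using ndims_nth[OF assms] by (auto simp: face_def nth_list_update split: if_splits)
  then show ?thesis using ndims_nth[OF assms] by (simp add: cdim_card)
qed

lemma rk_face:
  assumes "k < cdim \<sigma>"
  shows "rk (face \<sigma> k c) i = (if ndims \<sigma> ! k < i then rk \<sigma> i - 1 else rk \<sigma> i)"
proof -
  have "{j. j < i \<and> snd (face \<sigma> k c ! j)} = {j. j < i \<and> snd (\<sigma> ! j)} - {ndims \<sigma> ! k}"
    using ndims_nth[OF assms] by (auto simp: face_def nth_list_update split: if_splits)
  then show ?thesis using ndims_nth[OF assms] by (auto simp: rk_def card_Diff_singleton_if)
qed

lemma cpt_face:
  assumes k: "k < cdim \<sigma>"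
  shows "cpt (face \<sigma> k c) x = cpt \<sigma> (insert_dom x k c)"
proof (rule nth_equalityI)
  let ?j = "ndims \<sigma> ! k"
  fix i assume i: "i < length (cpt (face \<sigma> k c) x)"
  consider "i = ?j" | "i < ?j" | "i > ?j" by linarith
  then show "cpt (face \<sigma> k c) x ! i = cpt \<sigma> (insert_dom x k c) ! i"
  proof cases
    case 1
    then show ?thesis using i ndims_nth[OF k] rk_ndims_nth[OF k]
      by (simp add: nth_cpt insert_dom_def) (simp add: face_def)
  next
    case 2
    then have "snd (\<sigma> ! i) \<Longrightarrow> rk \<sigma> i < k" using rk_less[OF 2, of \<sigma>] rk_ndims_nth[OF k] by simp
    then show ?thesis using i 2
      by (simp add: nth_cpt insert_dom_def rk_face[OF k]) (simp add: face_def)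
  next
    case 3
    then have "k < rk \<sigma> i" using rk_less[OF 3, of \<sigma>] rk_ndims_nth[OF k] ndims_nth[OF k] by simp
    then show ?thesis using i 3
      by (simp add: nth_cpt insert_dom_def rk_face[OF k]) (simp add: face_def)
  qed
qed simp

section \<open>Normal forms of embeddings and their coefficients\<close>

lemma has_form_image:
  assumes h: "has_form f \<sigma> \<tau> \<pi> e" and c: "cdim \<tau> = cdim \<sigma>"
  shows "f ` cube_set \<sigma> = cube_set \<tau>"
proof
  have p: "\<pi> permutes {..<cdim \<sigma>}" using h by (simp add: has_form_def)
  have f: "f (cpt \<sigma> x) = cpt \<tau> (\<lambda>i. if e i then 1 - x (\<pi> i) else x (\<pi> i))" if "\<forall>i. x i \<in> {0,1}" for x :: "nat \<Rightarrow> int"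
    using h that by (auto simp: has_form_def)
  show "f ` cube_set \<sigma> \<subseteq> cube_set \<tau>"
  proof (rule image_subsetI)
    fix p assume "p \<in> cube_set \<sigma>"
    then obtain x where x: "\<forall>i. x i \<in> {0,1}" "p = cpt \<sigma> x" by (rule cube_setE)
    have "(if e i then 1 - x (\<pi> i) else x (\<pi> i)) \<in> {0,1}" for i using x(1)[rule_format, of "\<pi> i"] by auto
    then show "f p \<in> cube_set \<tau>" unfolding x(2) f[OF x(1)] by (intro cpt_in_cube_set) blast
  qed
  show "cube_set \<tau> \<subseteq> f ` cube_set \<sigma>"
  proof
    fix p assume "p \<in> cube_set \<tau>"
    then obtain y where y: "\<forall>i. y i \<in> {0,1}" "p = cpt \<tau> y" by (rule cube_setE)
    define x where "x = (\<lambda>j. if e (inv_into UNIV \<pi> j) then 1 - y (inv_into UNIV \<pi> j) else y (inv_into UNIV \<pi> j))"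
    have x: "\<forall>i. x i \<in> {0,1}" using y(1) by (auto simp: x_def)
    have "f (cpt \<sigma> x) = p"
      unfolding f[OF x] y(2) by (rule cpt_cong) (simp add: x_def permutes_inverses[OF p])
    then show "p \<in> f ` cube_set \<sigma>" using x by (auto simp: cube_set_eq)
  qed
qed

text \<open>The origin reveals the flips, and the indicator of \<open>\<pi> i\<close> reveals the
  permutation; beyond the dimension both are fixed by convention. Hence the choice made in
  \<open>fcoef\<close> is forced.\<close>

lemma has_form_unique:
  assumes h: "has_form f \<sigma> \<tau> \<pi> e" "has_form f \<sigma> \<tau> \<pi>' e'" and c: "cdim \<tau> = cdim \<sigma>"
  shows "\<pi> = \<pi>' \<and> e = e'"
proof -
  have eq: "(if e i then 1 - x (\<pi> i) else x (\<pi> i)) = (if e' i then 1 - x (\<pi>' i) else x (\<pi>' i))"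
    if x: "\<forall>i. x i \<in> {0,1}" and i: "i < cdim \<sigma>" for x :: "nat \<Rightarrow> int" and i
  proof -
    have "cpt \<tau> (\<lambda>i. if e i then 1 - x (\<pi> i) else x (\<pi> i)) = cpt \<tau> (\<lambda>i. if e' i then 1 - x (\<pi>' i) else x (\<pi>' i))"
      using h x by (auto simp: has_form_def)
    from cpt_inj[OF this, of i] show ?thesis using i c by simp
  qed
  have e: "e i = e' i" for i
  proof (cases "i < cdim \<sigma>")
    case True
    then show ?thesis using eq[of "\<lambda>_. 0" i] by (auto split: if_splits)
  next
    case False
    then show ?thesis using h by (auto simp: has_form_def)
  qed
  have "\<pi> i = \<pi>' i" for i
  proof (cases "i < cdim \<sigma>")
    case True
    moreover have "\<forall>j. (if j = \<pi> i then 1 else 0 :: int) \<in> {0, 1}" by simp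
    ultimately show ?thesis using eq[of "\<lambda>j. if j = \<pi> i then 1 else 0" i] e[of i] by (auto split: if_splits)
  next
    case False
    then show ?thesis using h by (auto simp: has_form_def permutes_def)
  qed
  then show ?thesis using e by blast
qed

lemma fcoef_has_form:
  assumes h: "has_form f \<sigma> \<tau> \<pi> e" and c: "cdim \<tau> = cdim \<sigma>"
  shows "fcoef f \<sigma> \<tau> = of_int (sign \<pi>) * (-1) ^ card {i. i < cdim \<sigma> \<and> e i}"
proof -
  have "pe = (\<pi>, e)" if "has_form f \<sigma> \<tau> (fst pe) (snd pe)" for pe
    using has_form_unique[OF that h c] by (simp add: prod_eq_iff)
  then have "(SOME pe. has_form f \<sigma> \<tau> (fst pe) (snd pe)) = (\<pi>, e)"
    using h by (intro some_equality) auto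
  then show ?thesis using h c has_form_image[OF h c] by (auto simp: fcoef_def)
qed

lemma fcoef_nonzeroD:
  assumes "\<tau> \<in> supp (fcoef f \<sigma>)"
  shows "cdim \<tau> = cdim \<sigma>" "f ` cube_set \<sigma> = cube_set \<tau>" "\<exists>\<pi> e. has_form f \<sigma> \<tau> \<pi> e"
  using assms by (auto simp: fcoef_def supp_def split: if_splits)

text \<open>A cube contributes at most one cube to the image. This turns the number of facets into a
  bound on the number of cubes in the image of the boundary.\<close>

lemma supp_fcoef_unique:
  assumes "\<tau> \<in> supp (fcoef f \<sigma>)" "\<tau>' \<in> supp (fcoef f \<sigma>)"
  shows "\<tau> = \<tau>'"
  using fcoef_nonzeroD(2)[OF assms(1)] fcoef_nonzeroD(2)[OF assms(2)] cube_set_inj by metis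

lemma finite_supp_fcoef: "finite (supp (fcoef f \<sigma>))"
proof (cases "supp (fcoef f \<sigma>) = {}")
  case False
  then obtain \<tau> where "\<tau> \<in> supp (fcoef f \<sigma>)" by blast
  then have "supp (fcoef f \<sigma>) \<subseteq> {\<tau>}" using supp_fcoef_unique by blast
  then show ?thesis by (rule finite_subset) simp
qed simp

lemma has_form_cong:
  assumes "cdim \<sigma> = cdim \<sigma>'" "\<And>x. \<forall>i<cdim \<sigma>. x i \<in> {0,1} \<Longrightarrow> f (cpt \<sigma> x) = f' (cpt \<sigma>' x)"
  shows "has_form f \<sigma> \<tau> = has_form f' \<sigma>' \<tau>"
  using assms by (intro ext) (simp add: has_form_def)

text \<open>The coefficients depend only on the map in local coordinates. So different cubes can be
  compared, even in grids of different dimension: the two ends of a collapsed edge, or a cube and an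
  end of its prism.\<close>

lemma fcoef_cong:
  assumes c: "cdim \<sigma> = cdim \<sigma>'" and "\<And>x. \<forall>i<cdim \<sigma>. x i \<in> {0,1} \<Longrightarrow> f (cpt \<sigma> x) = f' (cpt \<sigma>' x)"
  shows "fcoef f \<sigma> = fcoef f' \<sigma>'"
proof
  fix \<tau>
  have hf: "has_form f \<sigma> \<tau> = has_form f' \<sigma>' \<tau>" using assms by (rule has_form_cong)
  have "f ` cube_set \<sigma> = f' ` cube_set \<sigma>'"
    unfolding cube_set_eq image_image using assms(2) by (intro image_cong) auto
  then show "fcoef f \<sigma> \<tau> = fcoef f' \<sigma>' \<tau>"
    unfolding fcoef_def c hf by simp
qed

section \<open>Restriction of an embedding to the facets\<close>

lemma insert_dom_neq: "a \<noteq> (k :: nat) \<Longrightarrow> insert_dom x k c a = x (delete_index k a)"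
  by (auto simp: insert_dom_def delete_index_def)

lemma insert_dom_eq [simp]: "insert_dom x (k :: nat) c k = c"
  by (simp add: insert_dom_def)

lemma insert_dom_insert_index [simp]: "insert_dom x k c (insert_index k a) = x a"
  by (auto simp: insert_dom_def insert_index_def)

text \<open>The image coordinate \<open>i\<close> depends on the coordinate \<open>\<pi> i\<close>
  alone, so freezing the latter at \<open>c\<close> freezes the former at \<open>c\<close> or at
  \<open>1 - c\<close>. The remaining coordinates are matched by the permutation with the entry at
  \<open>i\<close> deleted.\<close>

lemma has_form_face:
  assumes h: "has_form f \<sigma> \<tau> \<pi> e" and q: "cdim \<sigma> = Suc q" "cdim \<tau> = Suc q" and i: "i < Suc q"
    and c: "c \<in> {0, 1}"
  shows "has_form f (face \<sigma> (\<pi> i) c) (face \<tau> i (if e i then 1 - c else c))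
    (permutation_delete \<pi> i) (\<lambda>l. e (insert_index i l))"
proof -
  have p: "\<pi> permutes {..<Suc q}" and e0: "\<And>l. l \<ge> Suc q \<Longrightarrow> \<not> e l"
    and f: "\<And>x. (\<forall>i<Suc q. x i \<in> {0, 1}) \<Longrightarrow>
        f (cpt \<sigma> x) = cpt \<tau> (\<lambda>i. if e i then 1 - x (\<pi> i) else x (\<pi> i))"
    using h unfolding has_form_def q by auto
  have pi: "\<pi> i < Suc q" using permutes_in_image[OF p, of i] i by simp
  have cd: "cdim (face \<sigma> (\<pi> i) c) = q" using cdim_face[of "\<pi> i" \<sigma>] pi q by simp
  show ?thesis
    unfolding has_form_def cd
  proof (intro conjI allI impI)
    show "permutation_delete \<pi> i permutes {..<q}"
      using permutation_delete_permutes[of \<pi> q i] p i by (simp add: lessThan_atLeast0)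
    show "\<not> e (insert_index i l)" if "q \<le> l" for l
      using that i e0[of "Suc l"] by (cases "l < i") auto
    fix x :: "nat \<Rightarrow> int" assume x: "\<forall>i<q. x i \<in> {0, 1}"
    have x': "\<forall>l<Suc q. insert_dom x (\<pi> i) c l \<in> {0, 1}"
    proof (intro allI impI)
      fix l assume l: "l < Suc q"
      show "insert_dom x (\<pi> i) c l \<in> {0, 1}"
      proof (cases "l = \<pi> i")
        case False
        then have "delete_index (\<pi> i) l < q" using l pi by (auto simp: delete_index_def)
        then show ?thesis using x by (simp add: insert_dom_neq[OF False])
      qed (use c in simp)
    qed
    have "f (cpt (face \<sigma> (\<pi> i) c) x) =
        cpt \<tau> (\<lambda>l. if e l then 1 - insert_dom x (\<pi> i) c (\<pi> l) else insert_dom x (\<pi> i) c (\<pi> l))"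
      using pi q by (simp add: cpt_face f[OF x'])
    also have "\<dots> = cpt \<tau> (insert_dom (\<lambda>l. if e (insert_index i l) then 1 - x (permutation_delete \<pi> i l)
        else x (permutation_delete \<pi> i l)) i (if e i then 1 - c else c))"
    proof (rule cpt_cong)
      fix l
      show "(if e l then 1 - insert_dom x (\<pi> i) c (\<pi> l) else insert_dom x (\<pi> i) c (\<pi> l)) =
        insert_dom (\<lambda>l. if e (insert_index i l) then 1 - x (permutation_delete \<pi> i l)
          else x (permutation_delete \<pi> i l)) i (if e i then 1 - c else c) l"
      proof (cases "l = i")
        case False
        then obtain l' where l': "l = insert_index i l'" by (metis insert_delete_index)
        have "\<pi> l \<noteq> \<pi> i" using False permutes_inj[OF p] by (auto dest: injD)
        then show ?thesis
          by (simp add: l' insert_dom_neq permutation_delete_def delete_ran_def delete_dom_def)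
      qed simp
    qed
    also have "\<dots> = cpt (face \<tau> i (if e i then 1 - c else c))
        (\<lambda>l. if e (insert_index i l) then 1 - x (permutation_delete \<pi> i l) else x (permutation_delete \<pi> i l))"
      using i q by (simp add: cpt_face)
    finally show "f (cpt (face \<sigma> (\<pi> i) c) x) = cpt (face \<tau> i (if e i then 1 - c else c))
        (\<lambda>l. if e (insert_index i l) then 1 - x (permutation_delete \<pi> i l) else x (permutation_delete \<pi> i l))" .
  qed
qed

text \<open>The cofactor sign at row \<open>i\<close> and column \<open>\<pi> i\<close> of a
  permutation matrix.\<close>

lemma sign_permutation_delete:
  assumes "\<pi> permutes {..<Suc q}" "i < Suc q"
  shows "(of_int (sign \<pi>) :: rat) = (-1) ^ (i + \<pi> i) * of_int (sign (permutation_delete \<pi> i))"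
proof -
  have p: "\<pi> permutes {0..<Suc q}" using assms by (simp add: lessThan_atLeast0)
  have "\<pi> i < Suc q" using permutes_in_image[OF p, of i] assms by simp
  from signof_permutation_insert[OF permutation_delete_permutes[OF p assms(2)] assms(2) this, where 'a=rat]
  show ?thesis using permutation_insert_delete[OF p assms(2)] by simp
qed

lemma card_flips_delete:
  fixes e :: "nat \<Rightarrow> bool"
  assumes "i < Suc q"
  shows "card {l. l < Suc q \<and> e l} = (if e i then 1 else 0) + card {l. l < q \<and> e (insert_index i l)}"
proof -
  have "{l. l < Suc q \<and> e l} = {l \<in> {0..<Suc q} - {i}. e l} \<union> (if e i then {i} else {})"
    using assms by auto
  also have "{l \<in> {0..<Suc q} - {i}. e l} = insert_index i ` {l. l < q \<and> e (insert_index i l)}"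
    unfolding insert_index_image[OF assms, symmetric] by auto
  finally have *: "{l. l < Suc q \<and> e l} =
      insert_index i ` {l. l < q \<and> e (insert_index i l)} \<union> (if e i then {i} else {})" .
  have "i \<notin> insert_index i ` {l. l < q \<and> e (insert_index i l)}"
    using insert_index_exclude[of i] by (metis image_iff)
  then show ?thesis unfolding * using insert_index_inj_on[of i] by (auto simp: card_image)
qed

text \<open>A facet loses the cofactor sign and, if its direction is reversed, one flip. Both signs
  are their own inverses, so they can be moved to the side of the whole cube.\<close>

lemma fcoef_face:
  assumes h: "has_form f \<sigma> \<tau> \<pi> e" and q: "cdim \<sigma> = Suc q" "cdim \<tau> = Suc q" and i: "i < Suc q"
    and c: "c \<in> {0, 1}"
  shows "fcoef f (face \<sigma> (\<pi> i) c) \<rho> = (if \<rho> = face \<tau> i (if e i then 1 - c else c)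
    then (-1) ^ (i + \<pi> i) * (if e i then -1 else 1) * fcoef f \<sigma> \<tau> else 0)"
proof -
  have p: "\<pi> permutes {..<Suc q}" using h q by (simp add: has_form_def)
  have pi: "\<pi> i < Suc q" using permutes_in_image[OF p, of i] i by simp
  let ?\<rho> = "face \<tau> i (if e i then 1 - c else c)" and ?\<sigma> = "face \<sigma> (\<pi> i) c"
  have cd: "cdim ?\<sigma> = q" "cdim ?\<rho> = cdim ?\<sigma>" using cdim_face pi q i by simp_all
  define S :: rat where "S = of_int (sign (permutation_delete \<pi> i))"
  define E :: rat where "E = (-1) ^ card {l. l < q \<and> e (insert_index i l)}"
  define A :: rat where "A = (-1) ^ (i + \<pi> i)"
  have AA: "A * A = 1" by (simp add: A_def power_mult_distrib[symmetric])
  have st: "fcoef f \<sigma> \<tau> = A * S * ((if e i then -1 else 1) * E)"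
    using fcoef_has_form[OF h] sign_permutation_delete[OF p i] card_flips_delete[OF i, of e] q
    by (simp add: A_def S_def E_def)
  have "fcoef f ?\<sigma> ?\<rho> = S * E"
    using fcoef_has_form[OF has_form_face[OF h q i c] cd(2)] cd by (simp add: S_def E_def)
  also have "\<dots> = A * A * (S * E)" by (simp add: AA)
  also have "\<dots> = A * (if e i then -1 else 1) * fcoef f \<sigma> \<tau>"
    by (simp add: st)
  finally have 1: "fcoef f ?\<sigma> ?\<rho> = (-1) ^ (i + \<pi> i) * (if e i then -1 else 1) * fcoef f \<sigma> \<tau>"
    by (simp only: A_def)
  then have "?\<rho> \<in> supp (fcoef f ?\<sigma>)"
    using fcoef_has_form[OF h] q by (auto simp: supp_def sign_def)
  then have "fcoef f ?\<sigma> \<rho> = 0" if "\<rho> \<noteq> ?\<rho>"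
    using supp_fcoef_unique[of ?\<rho> f ?\<sigma> \<rho>] that by (auto simp: supp_def)
  then show ?thesis using 1 by auto
qed

text \<open>The facets of \<sigma> are reindexed by \<pi>. The boundary sign at
  \<open>\<pi> i\<close> times the cofactor sign is the boundary sign at \<open>i\<close>; in a
  reversed direction the upper and lower facets trade places, which the flip sign
  compensates.\<close>

lemma chain_map_embedding:
  assumes h: "has_form f \<sigma> \<tau> \<pi> e" and c: "cdim \<tau> = cdim \<sigma>"
  shows "lin (fcoef f) (bd_cube \<sigma>) = lin bd_cube (fcoef f \<sigma>)"
proof
  fix \<rho>
  have p: "\<pi> permutes {..<cdim \<sigma>}" using h by (simp add: has_form_def)
  have "fcoef f \<sigma> \<tau> \<noteq> 0" using fcoef_has_form[OF h c] by (simp add: sign_def)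
  then have "supp (fcoef f \<sigma>) \<subseteq> {\<tau>}" using supp_fcoef_unique[of \<tau>] by (auto simp: supp_def)
  then have r: "lin bd_cube (fcoef f \<sigma>) \<rho> = fcoef f \<sigma> \<tau> * bd_cube \<tau> \<rho>" by (rule lin_single)
  have "lin (fcoef f) (bd_cube \<sigma>) \<rho> =
      (\<Sum>k<cdim \<sigma>. (-1) ^ (k + 1) * (fcoef f (face \<sigma> k 0) \<rho> - fcoef f (face \<sigma> k 1) \<rho>))"
    by (simp add: lin_bd_cube faceA_face faceB_face)
  also have "\<dots> = (\<Sum>i<cdim \<sigma>. (-1) ^ (\<pi> i + 1) * (fcoef f (face \<sigma> (\<pi> i) 0) \<rho> - fcoef f (face \<sigma> (\<pi> i) 1) \<rho>))"
    by (subst sum.permute[OF p]) (simp add: o_def)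
  also have "\<dots> = (\<Sum>i<cdim \<sigma>. fcoef f \<sigma> \<tau> * ((-1) ^ (i + 1) *
      ((if \<rho> = face \<tau> i 0 then 1 else 0) - (if \<rho> = face \<tau> i 1 then 1 else 0))))"
  proof (rule sum.cong[OF refl])
    fix i assume "i \<in> {..<cdim \<sigma>}"
    then obtain q where q: "cdim \<sigma> = Suc q" "cdim \<tau> = Suc q" "i < Suc q" using c by (cases "cdim \<sigma>") auto
    have s: "(-1::rat) ^ \<pi> i * (-1) ^ (i + \<pi> i) = (-1) ^ i"
      by (simp add: power_add[symmetric] mult_2[symmetric] uminus_power_if)
    have s': "(-1::rat) ^ \<pi> i * ((-1) ^ (i + \<pi> i) * w) = (-1) ^ i * w" for w
      using s by (simp add: mult.assoc[symmetric])
    show "(-1) ^ (\<pi> i + 1) * (fcoef f (face \<sigma> (\<pi> i) 0) \<rho> - fcoef f (face \<sigma> (\<pi> i) 1) \<rho>) =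
      fcoef f \<sigma> \<tau> * ((-1) ^ (i + 1) *
      ((if \<rho> = face \<tau> i 0 then 1 else 0) - (if \<rho> = face \<tau> i 1 then 1 else 0)))"
      using fcoef_face[OF h q, of 0 \<rho>] fcoef_face[OF h q, of 1 \<rho>]
      by (auto simp: s' right_diff_distrib mult.assoc)
  qed
  also have "\<dots> = fcoef f \<sigma> \<tau> * bd_cube \<tau> \<rho>"
    by (simp only: bd_cube_def faceA_face faceB_face c sum_distrib_left)
  finally show "lin (fcoef f) (bd_cube \<sigma>) \<rho> = lin bd_cube (fcoef f \<sigma>) \<rho>" unfolding r .
qed

section \<open>Cubes all of whose squares are embedded\<close>

lemma c1_adjE:
  assumes "c1_adj a b" "length a = n"
  obtains m s where "m < n" "s = 1 \<or> s = -1" "length b = n"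
    "\<forall>k<n. b ! k = a ! k + (if k = m then s else 0)"
proof -
  from assms obtain m where m: "m < n" "\<bar>a ! m - b ! m\<bar> = 1" "\<forall>k<n. k \<noteq> m \<longrightarrow> a ! k = b ! k" "length b = n"
    unfolding c1_adj_def by auto
  show thesis
    by (rule that[of m "b ! m - a ! m"]) (use m in auto)
qed

text \<open>Both paths from \<open>a\<close> to \<open>d\<close> add two unit steps to the same
  total. Since \<open>b \<noteq> c\<close> the first steps differ, and since
  \<open>a \<noteq> d\<close> no path turns back. So the paths take the same two steps in opposite
  order, along different axes.\<close>

lemma square_parallel:
  assumes n: "length a = n" and ab: "c1_adj a b" and ac: "c1_adj a c" and bd: "c1_adj b d" and cd: "c1_adj c d"
    and ad: "a \<noteq> d" and bc: "b \<noteq> c"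
  obtains m m' s s' where "m \<noteq> m'" "s = 1 \<or> s = -1" "s' = 1 \<or> s' = -1"
    "\<forall>k<n. b ! k = a ! k + (if k = m then s else 0)"
    "\<forall>k<n. c ! k = a ! k + (if k = m' then s' else 0)"
    "\<forall>k<n. d ! k = a ! k + (if k = m then s else 0) + (if k = m' then s' else 0)"
proof -
  obtain m1 s1 where 1: "m1 < n" "s1 = 1 \<or> s1 = -1" "length b = n"
    "\<forall>k<n. b ! k = a ! k + (if k = m1 then s1 else 0)" by (rule c1_adjE[OF ab n])
  obtain m2 s2 where 2: "m2 < n" "s2 = 1 \<or> s2 = -1" "length c = n"
    "\<forall>k<n. c ! k = a ! k + (if k = m2 then s2 else 0)" by (rule c1_adjE[OF ac n])
  obtain m3 s3 where 3: "m3 < n" "s3 = 1 \<or> s3 = -1" "length d = n"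
    "\<forall>k<n. d ! k = b ! k + (if k = m3 then s3 else 0)" by (rule c1_adjE[OF bd 1(3)])
  obtain m4 s4 where 4: "m4 < n" "s4 = 1 \<or> s4 = -1" "length d = n"
    "\<forall>k<n. d ! k = c ! k + (if k = m4 then s4 else 0)" by (rule c1_adjE[OF cd 2(3)])
  have eq: "(if k = m1 then s1 else 0) + (if k = m3 then s3 else 0) =
      (if k = m2 then s2 else 0) + (if k = m4 then s4 else 0)" if "k < n" for k
    using that 1(4) 2(4) 3(4) 4(4) by (smt (verit))
  have A: "\<not> (m1 = m2 \<and> s1 = s2)"
  proof
    assume "m1 = m2 \<and> s1 = s2"
    then have "b = c" using 1 2 by (intro nth_equalityI) auto
    then show False using bc by simp
  qed
  have B: "\<not> (m1 = m3 \<and> s3 = - s1)"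
  proof
    assume *: "m1 = m3 \<and> s3 = - s1"
    have "a = d" using 1 3 n * by (intro nth_equalityI) auto
    then show False using ad by simp
  qed
  have C: "\<not> (m2 = m4 \<and> s4 = - s2)"
  proof
    assume *: "m2 = m4 \<and> s4 = - s2"
    have "a = d" using 2 4 n * by (intro nth_equalityI) auto
    then show False using ad by simp
  qed
  have ne: "m1 \<noteq> m2"
    using eq[OF 1(1)] A B 1(2) 2(2) 3(2) 4(2) by (auto split: if_splits)
  have "m3 = m2 \<and> s3 = s2"
    using ne eq[OF 1(1)] eq[OF 2(1)] eq[OF 3(1)] C 1(2) 2(2) 3(2) 4(2) by (auto split: if_splits)
  then show thesis
    using that[of m1 m2 s1 s2] ne 1 2 3 by auto
qed

lemma c1_adj_cpt:
  assumes i: "i < cdim \<sigma>"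
  shows "c1_adj (cpt \<sigma> (x(i := 0))) (cpt \<sigma> (x(i := 1)))"
proof -
  let ?j = "ndims \<sigma> ! i"
  note j = ndims_nth[OF i] rk_ndims_nth[OF i]
  have "cpt \<sigma> (x(i := 0)) ! l = cpt \<sigma> (x(i := 1)) ! l" if "l < length \<sigma>" "l \<noteq> ?j" for l
    using that ndims_nth_rk[of l \<sigma>] by (auto simp: nth_cpt)
  then show ?thesis
    unfolding c1_adj_def by (intro conjI exI[of _ ?j]) (use j in \<open>simp_all add: nth_cpt\<close>)
qed

text \<open>By \<open>square_parallel\<close> the step of \<open>f\<close> in one direction does not
  change when another coordinate moves. Hence \<open>f\<close> is affine in the local coordinates,
  with a signed unit vector for each direction and different axes for different directions; this is
  a normal form.\<close>

lemma has_form_of_squares: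
  fixes f :: "int list \<Rightarrow> int list" and \<sigma> :: cube and n q :: nat
  defines "P \<equiv> \<lambda>x. f (cpt \<sigma> x)"
  assumes q: "cdim \<sigma> = q"
    and cont: "\<And>p p'. p \<in> cube_set \<sigma> \<Longrightarrow> p' \<in> cube_set \<sigma> \<Longrightarrow> c1_adj p p' \<Longrightarrow> f p = f p' \<or> c1_adj (f p) (f p')"
    and len: "\<And>p. p \<in> cube_set \<sigma> \<Longrightarrow> length (f p) = n"
    and edge: "\<And>x i. \<forall>l. x l \<in> {0,1} \<Longrightarrow> i < q \<Longrightarrow> P (x(i := 0)) \<noteq> P (x(i := 1))"
    and diag: "\<And>x i j. \<forall>l. x l \<in> {0,1} \<Longrightarrow> i < q \<Longrightarrow> j < q \<Longrightarrow> i \<noteq> j \<Longrightarrow>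
      P (x(i := 0, j := 0)) \<noteq> P (x(i := 1, j := 1)) \<and> P (x(i := 1, j := 0)) \<noteq> P (x(i := 0, j := 1))"
  shows "\<exists>\<tau> \<pi> e. cdim \<tau> = q \<and> has_form f \<sigma> \<tau> \<pi> e"
proof -
  define ok :: "(nat \<Rightarrow> int) \<Rightarrow> bool" where "ok x \<longleftrightarrow> (\<forall>l. x l \<in> {0,1})" for x
  have okU: "ok (x(i := 0))" "ok (x(i := 1))" if "ok x" for x i using that by (auto simp: ok_def)
  have okc: "cpt \<sigma> x \<in> cube_set \<sigma>" if "ok x" for x
    using that by (intro cpt_in_cube_set) (simp add: ok_def)
  have lenP: "length (P x) = n" if "ok x" for x using len okc that by (simp add: P_def)
  have adj: "c1_adj (P (x(i := 0))) (P (x(i := 1)))" if x: "ok x" and i: "i < q" for x i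
  proof -
    have "c1_adj (cpt \<sigma> (x(i := 0))) (cpt \<sigma> (x(i := 1)))" using i q by (simp add: c1_adj_cpt)
    from cont[OF okc okc this] have "P (x(i := 0)) = P (x(i := 1)) \<or> c1_adj (P (x(i := 0))) (P (x(i := 1)))"
      using okU[OF x] by (simp add: P_def)
    then show ?thesis using edge[of x i] x i by (auto simp: ok_def)
  qed
  \<comment> \<open>The discrete partial derivative in direction \<open>i\<close>, read off at
    output position \<open>c\<close>.\<close>
  define d where "d i x c = P (x(i := 1)) ! c - P (x(i := 0)) ! c" for i x c
  have sq: "\<exists>m m' s s'. m \<noteq> m' \<and> (s = 1 \<or> s = -1) \<and> (s' = 1 \<or> s' = -1) \<and> (\<forall>c<n.
      d i (x(j := 0)) c = (if c = m then s else 0) \<and> d i (x(j := 1)) c = (if c = m then s else 0) \<and>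
      d j (x(i := 0)) c = (if c = m' then s' else 0))"
    if x: "ok x" and i: "i < q" and j: "j < q" and ij: "i \<noteq> j" for x i j
  proof -
    have 1: "c1_adj (P (x(i := 0, j := 0))) (P (x(i := 1, j := 0)))"
      using adj[OF okU(1)[OF x, of j] i] ij by (simp add: fun_upd_twist)
    have 2: "c1_adj (P (x(i := 0, j := 0))) (P (x(i := 0, j := 1)))"
      using adj[OF okU(1)[OF x, of i] j] .
    have 3: "c1_adj (P (x(i := 1, j := 0))) (P (x(i := 1, j := 1)))"
      using adj[OF okU(2)[OF x, of i] j] .
    have 4: "c1_adj (P (x(i := 0, j := 1))) (P (x(i := 1, j := 1)))"
      using adj[OF okU(2)[OF x, of j] i] ij by (simp add: fun_upd_twist)
    have D: "P (x(i := 0, j := 0)) \<noteq> P (x(i := 1, j := 1))" "P (x(i := 1, j := 0)) \<noteq> P (x(i := 0, j := 1))"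
      using diag[of x i j] x i j ij by (auto simp: ok_def)
    have l: "length (P (x(i := 0, j := 0))) = n" by (intro lenP okU x)
    obtain m m' s s' where "m \<noteq> m'" "s = 1 \<or> s = -1" "s' = 1 \<or> s' = -1"
      "\<forall>k<n. P (x(i := 1, j := 0)) ! k = P (x(i := 0, j := 0)) ! k + (if k = m then s else 0)"
      "\<forall>k<n. P (x(i := 0, j := 1)) ! k = P (x(i := 0, j := 0)) ! k + (if k = m' then s' else 0)"
      "\<forall>k<n. P (x(i := 1, j := 1)) ! k = P (x(i := 0, j := 0)) ! k + (if k = m then s else 0) + (if k = m' then s' else 0)"
      by (rule square_parallel[OF l 1 2 3 4 D])
    moreover have "x(j := v, i := w) = x(i := w, j := v)" for v w using ij by (intro fun_upd_twist) auto
    ultimately show ?thesis unfolding d_def by (intro exI[of _ m] exI[of _ m'] exI[of _ s] exI[of _ s']) simp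
  qed
  have indep: "d i (x(j := v)) c = d i x c"
    if x: "ok x" and i: "i < q" and j: "j < q" and v: "v \<in> {0,1}" and c: "c < n" for x i j v c
  proof (cases "i = j")
    case False
    have "d i (x(j := 0)) c = d i (x(j := 1)) c" using sq[OF x i j False] c by auto
    moreover have "x j = 0 \<or> x j = 1" using x by (auto simp: ok_def)
    ultimately show ?thesis using v fun_upd_triv[of x j] by (metis insert_iff singletonD)
  qed (simp add: d_def)
  define x0 :: "nat \<Rightarrow> int" where "x0 = (\<lambda>_. 0)"
  have ok0: "ok x0" by (simp add: ok_def x0_def)
  \<comment> \<open>Truncations lead from the origin to \<open>x\<close> by switching on one
    coordinate at a time, so that the increments telescope.\<close>
  define tr where "tr x k = (\<lambda>l. if l < k then x l else 0)" for x :: "nat \<Rightarrow> int" and k :: nat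
  have oktr: "ok (tr x k)" if "ok x" for x k using that by (simp add: ok_def tr_def)
  have trS: "tr x (Suc k) = (tr x k)(k := x k)" for x k by (auto simp: tr_def fun_eq_iff)
  have tr0: "tr x 0 = x0" for x by (simp add: tr_def x0_def)
  have dtr: "d i (tr x k) c = d i x0 c" if x: "ok x" and i: "i < q" and c: "c < n" and k: "k \<le> q" for i x c k
    using k
  proof (induction k)
    case (Suc k)
    have "x k \<in> {0,1}" using x by (simp add: ok_def)
    then have "d i (tr x (Suc k)) c = d i (tr x k) c"
      unfolding trS using Suc.prems by (intro indep oktr x i c) auto
    then show ?case using Suc by simp
  qed (simp add: tr0)
  have Ptr: "P (tr x k) ! c = P x0 ! c + (\<Sum>i<k. x i * d i x0 c)" if x: "ok x" and c: "c < n" and k: "k \<le> q" for x c k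
    using k
  proof (induction k)
    case (Suc k)
    have e: "(tr x k)(k := 0) = tr x k" by (auto simp: tr_def)
    have "x k = 0 \<or> x k = 1" using x by (auto simp: ok_def)
    moreover have "P ((tr x k)(k := 1)) ! c = P (tr x k) ! c + d k x0 c"
      using dtr[OF x _ c, of k k] Suc.prems by (simp add: d_def[of k "tr x k"] e)
    moreover have "P (tr x (Suc k)) = P (tr x k)" if "x k = 0" using trS[of x k] e that by metis
    moreover have "P (tr x (Suc k)) = P ((tr x k)(k := 1))" if "x k = 1" using trS[of x k] that by metis
    ultimately show ?case using Suc by auto
  qed (simp add: tr0)
  have "\<exists>m s. m < n \<and> (s = 1 \<or> s = -1) \<and> (\<forall>c<n. d i x0 c = (if c = m then s else 0))" if iq: "i < q" for i
  proof -
    have l: "length (P (x0(i := 0))) = n" by (intro lenP okU ok0)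
    obtain m s where "m < n" "s = 1 \<or> s = -1" "\<forall>k<n. P (x0(i := 1)) ! k = P (x0(i := 0)) ! k + (if k = m then s else 0)"
      by (rule c1_adjE[OF adj[OF ok0 iq] l])
    then show ?thesis by (auto simp: d_def intro!: exI[of _ m] exI[of _ s])
  qed
  then obtain m s where m: "\<And>i. i < q \<Longrightarrow> m i < n" and s: "\<And>i. i < q \<Longrightarrow> s i = 1 \<or> s i = -1"
    and ms: "\<And>i c. i < q \<Longrightarrow> c < n \<Longrightarrow> d i x0 c = (if c = m i then s i else 0)"
    by metis
  have minj: "inj_on m {..<q}"
  proof (rule inj_onI, rule ccontr)
    fix i j assume i: "i \<in> {..<q}" and j: "j \<in> {..<q}" and eq: "m i = m j" and "i \<noteq> j"
    then have "i < q" "j < q" by auto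
    obtain m1 m2 s1 s2 where "m1 \<noteq> m2" "s1 = 1 \<or> s1 = -1" "s2 = 1 \<or> s2 = -1" "\<forall>c<n.
      d i (x0(j := 0)) c = (if c = m1 then s1 else 0) \<and> d j (x0(i := 0)) c = (if c = m2 then s2 else 0)"
      using sq[OF ok0 \<open>i < q\<close> \<open>j < q\<close> \<open>i \<noteq> j\<close>] by blast
    moreover have "x0(l := 0) = x0" for l by (auto simp: x0_def)
    ultimately have "\<forall>c<n. d i x0 c = (if c = m1 then s1 else 0) \<and> d j x0 c = (if c = m2 then s2 else 0)" "m1 \<noteq> m2"
      by auto
    then show False
      using ms[OF \<open>i < q\<close> m[OF \<open>i < q\<close>]] ms[OF \<open>j < q\<close> m[OF \<open>j < q\<close>]] eq m[OF \<open>i < q\<close>] s[OF \<open>i < q\<close>] s[OF \<open>j < q\<close>]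
      by (auto split: if_splits)
  qed
  have P1: "P x ! c = P x0 ! c + (\<Sum>i<q. x i * (if c = m i then s i else 0))" if x: "\<forall>l<q. x l \<in> {0,1}" and c: "c < n" for x c
  proof -
    have ok: "ok (tr x q)" using x by (simp add: ok_def tr_def)
    have "P x = P (tr x q)" unfolding P_def using q by (intro arg_cong[of _ _ f] cpt_cong) (simp add: tr_def)
    also have "tr x q = tr (tr x q) q" by (auto simp: tr_def)
    finally have "P x ! c = P x0 ! c + (\<Sum>i<q. tr x q i * d i x0 c)" using Ptr[OF ok c, of q] by simp
    also have "(\<Sum>i<q. tr x q i * d i x0 c) = (\<Sum>i<q. x i * (if c = m i then s i else 0))"
      by (intro sum.cong refl) (simp add: ms c tr_def)
    finally show ?thesis .
  qed
  have Pm: "P x ! (m i) = P x0 ! (m i) + x i * s i" if x: "\<forall>l<q. x l \<in> {0,1}" and i: "i < q" for x i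
  proof -
    have "(\<Sum>l<q. x l * (if m i = m l then s l else 0)) = (\<Sum>l<q. if l = i then x i * s i else 0)"
      using minj i by (intro sum.cong refl) (auto simp: inj_on_def)
    then show ?thesis using P1[OF x m[OF i]] i by simp
  qed
  have Pn: "P x ! c = P x0 ! c" if x: "\<forall>l<q. x l \<in> {0,1}" and c: "c < n" "c \<notin> m ` {..<q}" for x c
  proof -
    have "(\<Sum>l<q. x l * (if c = m l then s l else 0)) = 0"
      using c(2) by (intro sum.neutral) auto
    then show ?thesis using P1[OF x c(1)] by simp
  qed
  \<comment> \<open>Along an axis with negative step the image runs downwards from the image of the
    origin, so the factor of \<tau> starts one lower.\<close>
  define \<tau> :: cube where "\<tau> = map (\<lambda>c. if c \<in> m ` {..<q}
     then (P x0 ! c - (if s (inv_into {..<q} m c) = -1 then 1 else 0), True) else (P x0 ! c, False)) [0..<n]"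
  have len\<tau>: "length \<tau> = n" by (simp add: \<tau>_def)
  have \<tau>m: "\<tau> ! (m i) = (P x0 ! (m i) - (if s i = -1 then 1 else 0), True)" if "i < q" for i
    using that m[OF that] inv_into_f_f[OF minj, of i] by (auto simp: \<tau>_def)
  have \<tau>n: "\<tau> ! c = (P x0 ! c, False)" if "c < n" "c \<notin> m ` {..<q}" for c
    using that by (auto simp: \<tau>_def)
  have J: "{j. j < length \<tau> \<and> snd (\<tau> ! j)} = m ` {..<q}"
    using m \<tau>m \<tau>n len\<tau> by (auto, metis imageI lessThan_iff snd_conv)
  have cd: "cdim \<tau> = q" unfolding cdim_card J using minj by (simp add: card_image)
  \<comment> \<open>\<open>r\<close> sends a direction of \<sigma> to the local coordinate of \<tau>
    that it moves. A normal form asks for the source of each image coordinate, so \<pi> is the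
    inverse of \<open>r\<close>.\<close>
  define r where "r = rk \<tau> \<circ> m"
  have r: "bij_betw r {..<q} {..<q}"
    unfolding r_def using bij_betw_rk[of \<tau>] minj unfolding J cd
    by (intro bij_betw_trans[of m]) (auto simp: bij_betw_def)
  define \<pi> where "\<pi> i = (if i < q then inv_into {..<q} r i else i)" for i
  have "bij_betw \<pi> {..<q} {..<q}"
    using bij_betw_inv_into[OF r] by (rule bij_betw_cong[THEN iffD1, rotated]) (simp add: \<pi>_def)
  then have perm: "\<pi> permutes {..<q}" by (rule bij_imp_permutes) (simp add: \<pi>_def)
  have rq: "r i < q" if "i < q" for i using r that by (auto simp: bij_betw_def)
  have \<pi>r: "\<pi> (r i) = i" if "i < q" for i
    using that rq[OF that] bij_betw_inv_into_left[OF r, of i] by (simp add: \<pi>_def)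
  define e where "e i \<longleftrightarrow> i < q \<and> s (\<pi> i) = -1" for i
  have "has_form f \<sigma> \<tau> \<pi> e"
    unfolding has_form_def q
  proof (intro conjI allI impI)
    show "\<pi> permutes {..<q}" by (rule perm)
    show "\<not> e i" if "q \<le> i" for i using that by (simp add: e_def)
    fix x :: "nat \<Rightarrow> int" assume x: "\<forall>i<q. x i \<in> {0, 1}"
    let ?y = "\<lambda>i. if e i then 1 - x (\<pi> i) else x (\<pi> i)"
    have l: "length (f (cpt \<sigma> x)) = n" using len cpt_in_cube_set[of \<sigma> x] x q by simp
    show "f (cpt \<sigma> x) = cpt \<tau> ?y"
    proof (rule nth_equalityI)
      show "length (f (cpt \<sigma> x)) = length (cpt \<tau> ?y)" using l len\<tau> by simp
      fix c assume "c < length (f (cpt \<sigma> x))"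
      then have c: "c < n" using l by simp
      show "f (cpt \<sigma> x) ! c = cpt \<tau> ?y ! c"
      proof (cases "c \<in> m ` {..<q}")
        case True
        then obtain i where i: "i < q" "c = m i" by auto
        have "rk \<tau> (m i) = r i" by (simp add: r_def)
        then show ?thesis using Pm[OF x i(1)] s[OF i(1)] c i
          by (auto simp: nth_cpt len\<tau> \<tau>m e_def \<pi>r rq P_def)
      next
        case False
        then show ?thesis using Pn[OF x c False] c by (simp add: nth_cpt len\<tau> \<tau>n P_def)
      qed
    qed
  qed
  then show ?thesis using cd by blast
qed

section \<open>Continuous maps induce chain maps\<close>

lemma has_form_inj:
  assumes h: "has_form f \<sigma> \<tau> \<pi> e" and c: "cdim \<tau> = cdim \<sigma>"
  shows "inj_on f (cube_set \<sigma>)"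
proof (rule inj_onI)
  fix p p' assume "p \<in> cube_set \<sigma>" "p' \<in> cube_set \<sigma>" and eq: "f p = f p'"
  then obtain x y where x: "\<forall>i. x i \<in> {0,1}" "p = cpt \<sigma> x" and y: "\<forall>i. y i \<in> {0,1}" "p' = cpt \<sigma> y"
    by (metis cube_setE)
  have perm: "\<pi> permutes {..<cdim \<sigma>}" using h by (simp add: has_form_def)
  have "cpt \<tau> (\<lambda>i. if e i then 1 - x (\<pi> i) else x (\<pi> i)) = cpt \<tau> (\<lambda>i. if e i then 1 - y (\<pi> i) else y (\<pi> i))"
    using h eq x y by (auto simp: has_form_def)
  from cpt_inj[OF this] have e: "x (\<pi> i) = y (\<pi> i)" if "i < cdim \<sigma>" for i
    using that[unfolded c[symmetric]] by (fastforce split: if_splits)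
  have "x i = y i" if "i < cdim \<sigma>" for i
    using e[of "inv_into UNIV \<pi> i"] that permutes_inverses[OF perm] permutes_in_image[OF permutes_inv[OF perm], of i] by simp
  then show "p = p'" unfolding x y by (rule cpt_cong)
qed

lemma cube_set_face:
  assumes k: "k < cdim \<sigma>" and c: "c \<in> {0,1}"
  shows "cube_set (face \<sigma> k c) = cpt \<sigma> ` {x. (\<forall>i. x i \<in> {0,1}) \<and> x k = c}"
proof -
  have "(\<lambda>x. insert_dom x k c) ` {x. \<forall>i. x i \<in> {0,1}} = {x. (\<forall>i. x i \<in> {0,1}) \<and> x k = c}" (is "?L = ?R")
  proof
    show "?L \<subseteq> ?R" using c by (force simp: insert_dom_def)
    show "?R \<subseteq> ?L"
    proof
      fix x assume "x \<in> ?R"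
      then have "\<forall>i. x (insert_index k i) \<in> {0,1}" "x = insert_dom (\<lambda>i. x (insert_index k i)) k c"
        by (auto simp: insert_dom_def insert_index_def fun_eq_iff)
      then show "x \<in> ?L" by blast
    qed
  qed
  note e = this
  show ?thesis unfolding cube_set_eq[of "face \<sigma> k c"] e[symmetric] image_image
    by (rule image_cong[OF refl cpt_face[OF k]])
qed

lemma cube_set_face_subset:
  assumes "k < cdim \<sigma>" "c \<in> {0,1}"
  shows "cube_set (face \<sigma> k c) \<subseteq> cube_set \<sigma>"
  unfolding cube_set_face[OF assms] cube_set_eq[of \<sigma>] by blast

lemma cube_set_nonempty: "cube_set \<sigma> \<noteq> {}"
  unfolding cube_set_eq by (auto intro!: exI[of _ "\<lambda>_. 0"])

lemma length_cube_set: "p \<in> cube_set \<sigma> \<Longrightarrow> length p = length \<sigma>"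
  by (simp add: cube_set_def)

text \<open>The common length \<open>n\<close> puts all image cubes into one grid, as
  \<open>cycle_card_supp\<close> demands. Continuity is asked for on \<sigma> only, and therefore
  holds on its faces.\<close>

lemma chain_map_cube:
  assumes "\<And>p p'. p \<in> cube_set \<sigma> \<Longrightarrow> p' \<in> cube_set \<sigma> \<Longrightarrow> c1_adj p p' \<Longrightarrow> f p = f p' \<or> c1_adj (f p) (f p')"
    and "\<And>p. p \<in> cube_set \<sigma> \<Longrightarrow> length (f p) = n"
  shows "lin (fcoef f) (bd_cube \<sigma>) = lin bd_cube (fcoef f \<sigma>)"
  using assms
proof (induction "cdim \<sigma>" arbitrary: \<sigma> rule: less_induct)
  case less
  note cont = less.prems(1) and len = less.prems(2)
  show ?case
  proof (cases "\<exists>\<tau> \<pi> e. cdim \<tau> = cdim \<sigma> \<and> has_form f \<sigma> \<tau> \<pi> e")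
    case True
    then show ?thesis using chain_map_embedding by blast
  next
    case noform: False
    define q where "q = cdim \<sigma>"
    define z where "z = lin (fcoef f) (bd_cube \<sigma>)"
    have no: "\<not> (\<exists>\<tau> \<pi> e. cdim \<tau> = q \<and> has_form f \<sigma> \<tau> \<pi> e)" using noform by (simp add: q_def)
    note form = has_form_of_squares[OF q_def[symmetric] cont len]
    have "supp (fcoef f \<sigma>) = {}" using noform fcoef_nonzeroD[of _ f \<sigma>] by blast
    then have r: "lin bd_cube (fcoef f \<sigma>) = (\<lambda>_. 0)" by (simp add: lin_def)
    define ok :: "(nat \<Rightarrow> int) \<Rightarrow> bool" where "ok x \<longleftrightarrow> (\<forall>l. x l \<in> {0,1})" for x
    have face: "cube_set (face \<sigma> k c) = cpt \<sigma> ` {x. ok x \<and> x k = c}" if "k < q" "c \<in> {0,1}" for k c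
      using cube_set_face that by (simp add: q_def ok_def)
    have "supp z = {}"
    proof (rule ccontr)
      assume ne: "supp z \<noteq> {}"
      have "q \<noteq> 0"
      proof
        assume "q = 0"
        then have "z = (\<lambda>_. 0)" by (simp add: z_def lin_bd_cube q_def fun_eq_iff)
        then show False using ne by (simp add: supp_def)
      qed
      then consider "q = 1" | "q \<ge> 2" by linarith
      then show False
      proof cases
        case 1
        \<comment> \<open>Edges are treated apart, since their two endpoints share no facet. If the
          endpoints have the same image, their contributions to the boundary cancel.\<close>
        have "z = (\<lambda>_. 0)" if x: "ok x" and eq: "f (cpt \<sigma> (x(0 := 0))) = f (cpt \<sigma> (x(0 := 1)))" for x
        proof -
          have "cpt (face \<sigma> 0 c) y = cpt \<sigma> (x(0 := c))" for y c
            using 1 by (simp add: cpt_face q_def) (rule cpt_cong, simp add: insert_dom_def)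
          then have "fcoef f (face \<sigma> 0 0) = fcoef f (face \<sigma> 0 1)"
            using 1 eq by (intro fcoef_cong) (simp_all add: cdim_face q_def)
          then show ?thesis using 1 by (simp add: z_def fun_eq_iff lin_bd_cube q_def faceA_face faceB_face)
        qed
        then have "f (cpt \<sigma> (x(0 := 0))) \<noteq> f (cpt \<sigma> (x(0 := 1)))" if "ok x" for x
          using ne that by (auto simp: supp_def)
        then have "\<exists>\<tau> \<pi> e. cdim \<tau> = q \<and> has_form f \<sigma> \<tau> \<pi> e"
          using 1 by (intro form) (auto simp: ok_def)
        then show False using no by blast
      next
        case 2
        define I where "I = {..<q} \<times> {0, 1::int}"
        define S where "S i = supp (fcoef f (face \<sigma> (fst i) (snd i)))" for i
        have fI: "finite I" and cI: "card I = 2 * q" by (auto simp: I_def)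
        have fS: "finite (S i)" for i by (simp add: S_def finite_supp_fcoef)
        have cS: "card (S i) \<le> 1" for i
          using supp_fcoef_unique[of _ f "face \<sigma> (fst i) (snd i)"] fS[of i]
          by (auto simp: S_def card_le_Suc0_iff_eq)
        have bdS: "\<exists>i\<in>I. \<rho> = face \<sigma> (fst i) (snd i)" if "\<rho> \<in> supp (bd_cube \<sigma>)" for \<rho>
          using that by (rule supp_bd_cube) (auto simp: I_def q_def faceA_face faceB_face)
        have zS: "supp z \<subseteq> (\<Union>i\<in>I. S i)"
        proof -
          have "supp z \<subseteq> (\<Union>x\<in>supp (bd_cube \<sigma>). supp (fcoef f x))" unfolding z_def by (rule supp_lin)
          then show ?thesis using bdS unfolding S_def by blast
        qed
        have fz: "finite (supp z)" by (rule finite_subset[OF zS]) (use fI fS in auto)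
        have sub: "cube_set (face \<sigma> (fst i) (snd i)) \<subseteq> cube_set \<sigma>" if "i \<in> I" for i
          using cube_set_face_subset[of "fst i" \<sigma> "snd i"] that by (auto simp: I_def q_def)
        have cdS: "cdim (face \<sigma> (fst i) (snd i)) = q - 1" if "i \<in> I" for i
          using that cdim_face[of "fst i" \<sigma> "snd i"] by (auto simp: I_def q_def)
        have IH: "lin (fcoef f) (bd_cube \<rho>) = lin bd_cube (fcoef f \<rho>)" if "\<rho> \<in> supp (bd_cube \<sigma>)" for \<rho>
        proof -
          obtain i where i: "i \<in> I" "\<rho> = face \<sigma> (fst i) (snd i)" using bdS[OF \<open>\<rho> \<in> _\<close>] by blast
          have "cdim \<rho> < cdim \<sigma>" using cdS[OF i(1)] 2 i(2) by (simp add: q_def)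
          then show ?thesis
            by (rule less.hyps) (use sub[OF i(1)] cont len i(2) in blast)+
        qed
        have "lin bd_cube z = lin (\<lambda>\<rho>. lin bd_cube (fcoef f \<rho>)) (bd_cube \<sigma>)"
          unfolding z_def by (rule lin_lin) (simp_all add: finite_supp_bd_cube finite_supp_fcoef)
        also have "\<dots> = lin (\<lambda>\<rho>. lin (fcoef f) (bd_cube \<rho>)) (bd_cube \<sigma>)"
          by (rule lin_cong) (simp add: IH)
        also have "\<dots> = lin (fcoef f) (lin bd_cube (bd_cube \<sigma>))"
          by (rule lin_lin[symmetric]) (simp_all add: finite_supp_bd_cube)
        also have "lin bd_cube (bd_cube \<sigma>) = (\<lambda>_. 0)"
          using lin_bd_bd[of "\<lambda>\<rho>. if \<rho> = \<sigma> then 1 else 0" "length \<sigma>"] by simp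
        finally have cyc: "lin bd_cube z = (\<lambda>_. 0)" by simp
        have lS: "length \<rho> = n \<and> cdim \<rho> = q - 1" if i: "i \<in> I" and \<rho>: "\<rho> \<in> S i" for i \<rho>
        proof -
          have "f ` cube_set (face \<sigma> (fst i) (snd i)) = cube_set \<rho>" using fcoef_nonzeroD(2) \<rho> by (simp add: S_def)
          moreover obtain p where "p \<in> cube_set \<rho>" using cube_set_nonempty[of \<rho>] by blast
          ultimately obtain p' where "p = f p'" "p' \<in> cube_set \<sigma>" "length p = length \<rho>"
            using sub[OF i] length_cube_set[of p \<rho>] by blast
          then have "length \<rho> = n" using len[of p'] by simp
          moreover have "cdim \<rho> = q - 1" using fcoef_nonzeroD(1)[of \<rho>] \<rho> cdS[OF i] by (simp add: S_def)
          ultimately show ?thesis by simp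
        qed
        have card: "2 * q \<le> card (supp z)"
          using cycle_card_supp[OF fz _ cyc _ ne, of n "q - 1"] lS zS 2 by fastforce
        \<comment> \<open>If the other facets already covered the image of facet \<open>i\<close>,
          then \<open>supp z\<close> would have at most \<open>2 * q - 1\<close> cubes. So each
          facet produces a cube that no other facet produces: it is embedded, and different facets
          have different images.\<close>
        have U: "\<not> S i \<subseteq> (\<Union>j\<in>I - {i}. S j)" if i: "i \<in> I" for i
        proof
          assume "S i \<subseteq> (\<Union>j\<in>I - {i}. S j)"
          then have "supp z \<subseteq> (\<Union>j\<in>I - {i}. S j)" using zS by blast
          then have "card (supp z) \<le> card (\<Union>j\<in>I - {i}. S j)" using fI fS by (intro card_mono) auto
          also have "\<dots> \<le> (\<Sum>j\<in>I - {i}. card (S j))" using fI by (intro card_UN_le) simp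
          also have "\<dots> \<le> (\<Sum>j\<in>I - {i}. 1)" by (rule sum_mono) (use cS in auto)
          also have "\<dots> = 2 * q - 1" using fI i cI by simp
          finally show False using card 2 by simp
        qed
        have inj: "inj_on f (cube_set (face \<sigma> k c))" if "k < q" "c \<in> {0,1}" for k c
        proof -
          have "S (k, c) \<noteq> {}" using U[of "(k, c)"] that by (auto simp: I_def)
          then obtain \<rho> where \<rho>: "\<rho> \<in> supp (fcoef f (face \<sigma> k c))" by (auto simp: S_def)
          then obtain \<pi> e where "has_form f (face \<sigma> k c) \<rho> \<pi> e" using fcoef_nonzeroD(3) by blast
          then show ?thesis using fcoef_nonzeroD(1)[OF \<rho>] by (rule has_form_inj)
        qed
        have dist: "f ` cube_set (face \<sigma> k c) \<noteq> f ` cube_set (face \<sigma> k' c')"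
          if k: "k < q" "c \<in> {0,1}" "k' < q" "c' \<in> {0,1}" "k \<noteq> k'" for k c k' c'
        proof
          assume eq: "f ` cube_set (face \<sigma> k c) = f ` cube_set (face \<sigma> k' c')"
          have "S (k, c) \<subseteq> S (k', c')"
          proof
            fix \<rho> assume \<rho>: "\<rho> \<in> S (k, c)"
            obtain \<rho>' where \<rho>': "\<rho>' \<in> S (k', c')" using U[of "(k', c')"] k by (auto simp: I_def)
            have "cube_set \<rho> = cube_set \<rho>'"
              using fcoef_nonzeroD(2)[of \<rho> f "face \<sigma> k c"] fcoef_nonzeroD(2)[of \<rho>' f "face \<sigma> k' c'"] \<rho> \<rho>' eq
              by (simp add: S_def)
            then show "\<rho> \<in> S (k', c')" using \<rho>' cube_set_inj by blast
          qed
          then show False using U[of "(k, c)"] k by (auto simp: I_def)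
        qed
        \<comment> \<open>Vertices that agree in coordinate \<open>k\<close> lie in a common facet,
          on which \<open>f\<close> is injective.\<close>
        have sep: "f (cpt \<sigma> x) \<noteq> f (cpt \<sigma> y)"
          if "ok x" "ok y" "k < q" "x k = y k" "i < q" "x i \<noteq> y i" for x y k i
        proof
          assume "f (cpt \<sigma> x) = f (cpt \<sigma> y)"
          moreover have c: "x k \<in> {0,1}" using \<open>ok x\<close> by (simp add: ok_def)
          moreover have "cpt \<sigma> x \<in> cube_set (face \<sigma> k (x k))" "cpt \<sigma> y \<in> cube_set (face \<sigma> k (x k))"
            unfolding face[OF \<open>k < q\<close> c] using that by auto
          ultimately have "cpt \<sigma> x = cpt \<sigma> y" using inj[OF \<open>k < q\<close> c] by (auto dest: inj_onD)
          then show False using cpt_inj[of \<sigma> x y i] that by (simp add: q_def)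
        qed
        have "\<exists>\<tau> \<pi> e. cdim \<tau> = q \<and> has_form f \<sigma> \<tau> \<pi> e"
        proof (rule form)
          fix x :: "nat \<Rightarrow> int" and i assume x: "\<forall>l. x l \<in> {0,1}" and i: "i < q"
          \<comment> \<open>Since \<open>q \<ge> 2\<close>, the edge in direction \<open>i\<close>
            lies in a facet transverse to another direction \<open>k\<close>.\<close>
          obtain k where k: "k < q" "k \<noteq> i" using 2 that[of 0] that[of 1] by (cases "i = 0") auto
          show "f (cpt \<sigma> (x(i := 0))) \<noteq> f (cpt \<sigma> (x(i := 1)))"
            by (rule sep[of _ _ k i]) (use x i k in \<open>auto simp: ok_def\<close>)
        next
          fix x :: "nat \<Rightarrow> int" and i j assume x: "\<forall>l. x l \<in> {0,1}" and i: "i < q" and j: "j < q" and ij: "i \<noteq> j"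
          show "f (cpt \<sigma> (x(i := 0, j := 0))) \<noteq> f (cpt \<sigma> (x(i := 1, j := 1))) \<and>
            f (cpt \<sigma> (x(i := 1, j := 0))) \<noteq> f (cpt \<sigma> (x(i := 0, j := 1)))"
          proof (cases "\<exists>k<q. k \<noteq> i \<and> k \<noteq> j")
            case True
            then obtain k where k: "k < q" "k \<noteq> i" "k \<noteq> j" by blast
            show ?thesis
              by (intro conjI; rule sep[of _ _ k i]) (use x i k ij in \<open>auto simp: ok_def\<close>)
          next
            \<comment> \<open>Here \<sigma> is a square, and opposite corners share no facet. Were
              their images equal, the two edges joining them to a third corner would have the same
              image, contrary to \<open>dist\<close>.\<close>
            case False
            have im: "f ` cube_set (face \<sigma> k c) = {f (cpt \<sigma> (x(k := c, l := 0))), f (cpt \<sigma> (x(k := c, l := 1)))}"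
              if kl: "k = i \<and> l = j \<or> k = j \<and> l = i" and c: "c \<in> {0,1}" for k l c
            proof -
              have kq: "k < q" and neq: "l \<noteq> k" using kl i j ij by auto
              have agree: "cpt \<sigma> y = cpt \<sigma> (x(k := c, l := y l))" if "y k = c" for y
                by (rule cpt_cong) (use False that kl in \<open>auto simp: q_def\<close>)
              have "cube_set (face \<sigma> k c) = {cpt \<sigma> (x(k := c, l := 0)), cpt \<sigma> (x(k := c, l := 1))}" (is "_ = ?R")
              proof
                show "cube_set (face \<sigma> k c) \<subseteq> ?R"
                proof
                  fix p assume "p \<in> cube_set (face \<sigma> k c)"
                  then obtain y where y: "ok y" "y k = c" "p = cpt \<sigma> y" unfolding face[OF kq c] by blast
                  have "y l = 0 \<or> y l = 1" using y(1) by (auto simp: ok_def)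
                  then show "p \<in> ?R" using agree[of y, OF y(2)] y(3) by auto
                qed
                show "?R \<subseteq> cube_set (face \<sigma> k c)"
                  unfolding face[OF kq c] using x c neq by (auto simp: ok_def intro!: imageI)
              qed
              then show ?thesis by simp
            qed
            have tw: "x(j := v, i := w) = x(i := w, j := v)" for v w using ij by (intro fun_upd_twist) auto
            have "f ` cube_set (face \<sigma> i 0) \<noteq> f ` cube_set (face \<sigma> j 1)"
              "f ` cube_set (face \<sigma> i 0) \<noteq> f ` cube_set (face \<sigma> j 0)"
              by (rule dist; use i j ij in simp)+
            then show ?thesis
              using im[of i j 0] im[of j i 1] im[of j i 0] by (auto simp: tw)
          qed
        qed
        then show False using no by blast
      qed
    qed
    then show ?thesis unfolding r by (auto simp: z_def supp_def fun_eq_iff)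
  qed
qed

section \<open>The prism operator\<close>

lemma ndims_snoc: "ndims (\<sigma> @ [t]) = ndims \<sigma> @ (if snd t then [length \<sigma>] else [])"
proof -
  have "filter (\<lambda>i. snd ((\<sigma> @ [t]) ! i)) [0..<length \<sigma>] = filter (\<lambda>i. snd (\<sigma> ! i)) [0..<length \<sigma>]"
    by (rule filter_cong) (simp_all add: nth_append)
  then show ?thesis by (simp add: ndims_def)
qed

lemma cdim_snoc: "cdim (\<sigma> @ [t]) = (if snd t then Suc (cdim \<sigma>) else cdim \<sigma>)"
  by (simp add: cdim_def ndims_snoc)

lemma cpt_snoc_False: "cpt (\<sigma> @ [(a, False)]) x = cpt \<sigma> x @ [a]"
proof (rule nth_equalityI)
  fix i assume "i < length (cpt (\<sigma> @ [(a, False)]) x)"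
  then consider "i < length \<sigma>" | "i = length \<sigma>" by force
  then show "cpt (\<sigma> @ [(a, False)]) x ! i = (cpt \<sigma> x @ [a]) ! i"
  proof cases
    case 1
    then have "{j. j < i \<and> snd ((\<sigma> @ [(a, False)]) ! j)} = {j. j < i \<and> snd (\<sigma> ! j)}"
      by (auto simp: nth_append)
    then show ?thesis using 1 by (simp add: nth_cpt nth_append rk_def)
  next
    case 2
    then show ?thesis using length_cpt[of \<sigma> x] by (simp add: nth_cpt nth_append)
  qed
qed simp

lemma cube_set_snoc:
  "cube_set (\<sigma> @ [(a, b)]) = {p @ [t] | p t. p \<in> cube_set \<sigma> \<and> (t = a \<or> b \<and> t = a + 1)}" (is "?L = ?R")
proof
  show "?R \<subseteq> ?L"
    by (auto simp: cube_set_def nth_append less_Suc_eq)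
  show "?L \<subseteq> ?R"
  proof
    fix p assume p: "p \<in> ?L"
    then have l: "length p = Suc (length \<sigma>)" by (simp add: cube_set_def)
    then obtain p' t where p': "p = p' @ [t]" by (metis append_butlast_last_id length_0_conv nat.distinct(1))
    have l': "length p' = length \<sigma>" using l p' by simp
    have "p' \<in> cube_set \<sigma>"
      unfolding cube_set_def
    proof (intro CollectI conjI allI impI l')
      fix i assume "i < length \<sigma>"
      then show "p' ! i = fst (\<sigma> ! i) \<or> snd (\<sigma> ! i) \<and> p' ! i = fst (\<sigma> ! i) + 1"
        using p l' by (auto simp: cube_set_def p' nth_append dest!: spec[of _ i])
    qed
    moreover have "t = a \<or> b \<and> t = a + 1"
      using p l' by (auto simp: cube_set_def p' nth_append dest!: spec[of _ "length \<sigma>"])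
    ultimately show "p \<in> ?R" using p' by blast
  qed
qed

lemma face_snoc: "k < cdim \<sigma> \<Longrightarrow> face (\<sigma> @ [t]) k c = face \<sigma> k c @ [t]"
  using ndims_nth(1)[of k \<sigma>]
  by (simp add: face_def ndims_snoc nth_append cdim_def list_update_append)

lemma face_snoc_last: "face (\<sigma> @ [(0, True)]) (cdim \<sigma>) c = \<sigma> @ [(c, False)]"
  by (simp add: face_def ndims_snoc nth_append cdim_def list_update_append)

text \<open>Adjacency in the prism changes time or space but never both. So continuity of the two
  ends and closeness of their values make the prism map continuous.\<close>

lemma c1_adj_snoc:
  assumes "c1_adj (p @ [s]) (p' @ [t])"
  shows "p = p' \<or> (s = t \<and> c1_adj p p')"
proof -
  have l: "length p = length p'" using assms by (simp add: c1_adj_def)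
  obtain i where i: "i < Suc (length p)" "\<bar>(p @ [s]) ! i - (p' @ [t]) ! i\<bar> = 1"
    "\<And>j. j < Suc (length p) \<Longrightarrow> j \<noteq> i \<Longrightarrow> (p @ [s]) ! j = (p' @ [t]) ! j"
    using assms by (auto simp: c1_adj_def)
  show ?thesis
  proof (cases "i = length p")
    case True
    then have "p = p'" using i(3) l by (intro nth_equalityI) (auto simp: nth_append)
    then show ?thesis by simp
  next
    case False
    then have "i < length p" using i by simp
    moreover have "s = t" using i(3)[of "length p"] False l by (simp add: nth_append)
    moreover have "p ! j = p' ! j" if "j < length p" "j \<noteq> i" for j
      using i(3)[of j] that l by (simp add: nth_append)
    ultimately show ?thesis using i(2) l by (auto simp: c1_adj_def nth_append)
  qed
qed

text \<open>Time is the last coordinate, so that the faces of \<sigma> keep their indices and signs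
  in the prism over \<sigma>. On such a prism only the times 0 and 1 occur.\<close>

definition prism :: "(int list \<Rightarrow> int list) \<Rightarrow> (int list \<Rightarrow> int list) \<Rightarrow> int list \<Rightarrow> int list" where
  "prism f g p = (if last p = 0 then f (butlast p) else g (butlast p))"

lemma prism_snoc: "prism f g (p @ [t]) = (if t = 0 then f p else g p)"
  by (simp add: prism_def)

text \<open>The chain-map property is applied to the prism over \<sigma>. Its side faces are the
  prisms over the faces of \<sigma>; its bottom and top reproduce \<open>f\<close> and
  \<open>g\<close>. The time direction comes last, which gives the sign
  \<open>(-1) ^ (cdim \<sigma> + 1)\<close>.\<close>

lemma prism_identity:
  fixes f g :: "int list \<Rightarrow> int list"
  defines "D \<equiv> \<lambda>\<sigma>. fcoef (prism f g) (\<sigma> @ [(0, True)])"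
  assumes f: "digi_cont X X f" and g: "digi_cont X X g"
    and fg: "\<And>x. x \<in> X \<Longrightarrow> f x = g x \<or> c1_adj (f x) (g x)"
    and len: "\<And>x. x \<in> X \<Longrightarrow> length x = n" and \<sigma>: "cube_set \<sigma> \<subseteq> X"
  shows "lin bd_cube (D \<sigma>) \<tau> =
    lin D (bd_cube \<sigma>) \<tau> + (-1) ^ (cdim \<sigma> + 1) * (fcoef f \<sigma> \<tau> - fcoef g \<sigma> \<tau>)"
proof -
  let ?H = "prism f g" and ?\<sigma> = "\<sigma> @ [(0, True)]"
  have pts: "\<exists>x t. p = x @ [t] \<and> x \<in> X \<and> (t = 0 \<or> t = 1)" if "p \<in> cube_set ?\<sigma>" for p
    using that \<sigma> by (auto simp: cube_set_snoc)
  have fX: "f x \<in> X" "g x \<in> X" if "x \<in> X" for x using f g that by (auto simp: digi_cont_def)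
  have sym: "c1_adj a b \<Longrightarrow> c1_adj b a" for a b by (auto simp: c1_adj_def abs_minus_commute)
  have cont: "?H p = ?H p' \<or> c1_adj (?H p) (?H p')"
    if p: "p \<in> cube_set ?\<sigma>" and p': "p' \<in> cube_set ?\<sigma>" and adj: "c1_adj p p'" for p p'
  proof -
    obtain x t where x: "p = x @ [t]" "x \<in> X" "t = 0 \<or> t = 1" using pts[OF p] by blast
    obtain y s where y: "p' = y @ [s]" "y \<in> X" "s = 0 \<or> s = 1" using pts[OF p'] by blast
    have "x = y \<or> (t = s \<and> c1_adj x y)" using c1_adj_snoc adj x y by blast
    then show ?thesis
    proof
      assume "x = y"
      then show ?thesis using fg[OF x(2)] sym[of "f x" "g x"] x y by (auto simp: prism_snoc)
    next
      assume "t = s \<and> c1_adj x y"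
      then show ?thesis using f g x y by (auto simp: prism_snoc digi_cont_def)
    qed
  qed
  have lenH: "length (?H p) = n" if "p \<in> cube_set ?\<sigma>" for p
    using pts[OF that] fX len by (auto simp: prism_snoc)
  have e0: "fcoef ?H (\<sigma> @ [(0, False)]) = fcoef f \<sigma>" and e1: "fcoef ?H (\<sigma> @ [(1, False)]) = fcoef g \<sigma>"
    by (rule fcoef_cong; simp add: cdim_snoc cpt_snoc_False prism_snoc)+
  have "lin bd_cube (D \<sigma>) \<tau> = lin (fcoef ?H) (bd_cube ?\<sigma>) \<tau>"
    unfolding D_def using chain_map_cube[of ?\<sigma> ?H n, OF cont lenH] by simp
  also have "\<dots> = (\<Sum>k<cdim \<sigma>. (-1) ^ (k + 1) *
      (fcoef ?H (face ?\<sigma> k 0) \<tau> - fcoef ?H (face ?\<sigma> k 1) \<tau>)) +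
      (-1) ^ (cdim \<sigma> + 1) * (fcoef ?H (face ?\<sigma> (cdim \<sigma>) 0) \<tau> - fcoef ?H (face ?\<sigma> (cdim \<sigma>) 1) \<tau>)"
    by (simp add: lin_bd_cube cdim_snoc faceA_face faceB_face)
  also have "\<dots> = (\<Sum>k<cdim \<sigma>. (-1) ^ (k + 1) * (D (face \<sigma> k 0) \<tau> - D (face \<sigma> k 1) \<tau>)) +
      (-1) ^ (cdim \<sigma> + 1) * (fcoef f \<sigma> \<tau> - fcoef g \<sigma> \<tau>)"
    by (simp add: face_snoc face_snoc_last e0 e1 D_def)
  also have "\<dots> = lin D (bd_cube \<sigma>) \<tau> + (-1) ^ (cdim \<sigma> + 1) * (fcoef f \<sigma> \<tau> - fcoef g \<sigma> \<tau>)"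
    by (simp only: lin_bd_cube faceA_face faceB_face)
  finally show ?thesis .
qed

section \<open>Passage from cubes to the chains of a finite image\<close>

lemma finite_cubes:
  assumes "finite X"
  shows "finite (cubes n q X)"
proof (rule inj_on_finite[of cube_set])
  show "inj_on cube_set (cubes n q X)" using cube_set_inj by (auto intro: inj_onI)
  show "cube_set ` cubes n q X \<subseteq> Pow X" by (auto simp: cubes_def)
qed (use assms in simp)

lemma chains_supp: "z \<in> chains n X q \<longleftrightarrow> supp z \<subseteq> cubes n q X"
  by (auto simp: chains_def supp_def)

lemma bd_chain_lin: "finite X \<Longrightarrow> z \<in> chains n X q \<Longrightarrow> bd_chain n X q z = lin bd_cube z"
  unfolding bd_chain_def chains_supp by (rule ext, rule lin_superset[symmetric, OF finite_cubes])

lemma chain_map_lin: "finite X \<Longrightarrow> z \<in> chains n X q \<Longrightarrow> chain_map n X f q z = lin (fcoef f) z"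
  unfolding chain_map_def chains_supp by (rule ext, rule lin_superset[symmetric, OF finite_cubes])

lemma supp_scale: "supp (\<lambda>x. c * z x) \<subseteq> supp z"
  by (auto simp: supp_def)

lemma lin_scale:
  assumes "finite (supp z)"
  shows "lin K (\<lambda>x. c * z x) = (\<lambda>y. c * lin K z y)"
proof
  fix y
  have "lin K (\<lambda>x. c * z x) y = (\<Sum>x\<in>supp z. c * z x * K x y)"
    by (rule lin_superset[OF assms supp_scale])
  then show "lin K (\<lambda>x. c * z x) y = c * lin K z y" by (simp add: lin_def sum_distrib_left mult.assoc)
qed

text \<open>Extended linearly, \<open>prism_identity\<close> loses its term
  \<open>lin D (bd_cube \<sigma>)\<close> on a cycle, and the difference of the two maps is left as
  a boundary up to sign.\<close>

lemma homotopic_chain_maps_differ_by_bound: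
  assumes X: "finite X" and f: "digi_cont X X f" and g: "digi_cont X X g"
    and fg: "\<And>x. x \<in> X \<Longrightarrow> f x = g x \<or> c1_adj (f x) (g x)"
    and len: "\<And>x. x \<in> X \<Longrightarrow> length x = n" and z: "z \<in> cycles n X q"
  shows "(\<lambda>\<tau>. chain_map n X f q z \<tau> - chain_map n X g q z \<tau>) \<in> bounds n X q"
proof -
  define D where "D = (\<lambda>\<sigma>. fcoef (prism f g) (\<sigma> @ [(0, True)]))"
  define s :: rat where "s = (-1) ^ (q + 1)"
  have ss: "s * (s * a) = a" for a by (simp add: s_def power_mult_distrib[symmetric] mult.assoc[symmetric])
  have zc: "z \<in> chains n X q" and z0: "lin bd_cube z = (\<lambda>_. 0)"
    using z bd_chain_lin[OF X, of z n q] by (auto simp: cycles_def)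
  have sz: "supp z \<subseteq> cubes n q X" using zc by (simp add: chains_supp)
  have fz: "finite (supp z)" by (rule finite_subset[OF sz finite_cubes[OF X]])
  have fD: "finite (supp (D \<sigma>))" for \<sigma> by (simp add: D_def finite_supp_fcoef)
  have fX: "f x \<in> X" "g x \<in> X" if "x \<in> X" for x using f g that by (auto simp: digi_cont_def)
  have Dc: "supp (D \<sigma>) \<subseteq> cubes n (q + 1) X" if "\<sigma> \<in> cubes n q X" for \<sigma>
  proof
    fix \<rho> assume r: "\<rho> \<in> supp (D \<sigma>)"
    have \<sigma>: "cube_set \<sigma> \<subseteq> X" "cdim \<sigma> = q" using that by (auto simp: cubes_def)
    have "cube_set \<rho> = prism f g ` cube_set (\<sigma> @ [(0, True)])"
      using fcoef_nonzeroD(2)[OF r[unfolded D_def]] by simp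
    then have sub: "cube_set \<rho> \<subseteq> X" using fX \<sigma> by (auto simp: cube_set_snoc prism_snoc)
    obtain p where "p \<in> cube_set \<rho>" using cube_set_nonempty[of \<rho>] by blast
    then have "length \<rho> = n" using sub len length_cube_set[of p \<rho>] by auto
    then show "\<rho> \<in> cubes n (q + 1) X"
      using sub fcoef_nonzeroD(1)[OF r[unfolded D_def]] \<sigma> by (simp add: cubes_def cdim_snoc)
  qed
  have fDz: "finite (supp (lin D z))" by (rule finite_supp_lin[OF fz fD])
  have Dz: "lin D z \<in> chains n X (q + 1)"
    using supp_lin[of D z] Dc sz by (fastforce simp: chains_supp)
  \<comment> \<open>The sign \<open>s\<close> is its own inverse, so scaling the prism chain by it
    removes the sign of the identity.\<close>
  define w where "w = (\<lambda>\<rho>. s * lin D z \<rho>)"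
  have w: "w \<in> chains n X (q + 1)" using Dz supp_scale[of s "lin D z"] by (auto simp: chains_supp w_def)
  have "bd_chain n X (q + 1) w = (\<lambda>\<tau>. chain_map n X f q z \<tau> - chain_map n X g q z \<tau>)"
  proof
    fix \<tau>
    have "lin bd_cube (lin D z) \<tau> = lin (\<lambda>\<sigma>. lin bd_cube (D \<sigma>)) z \<tau>"
      using lin_lin[OF fz fD, of bd_cube] by simp
    also have "\<dots> = (\<Sum>\<sigma>\<in>supp z. z \<sigma> * (lin D (bd_cube \<sigma>) \<tau> + s * (fcoef f \<sigma> \<tau> - fcoef g \<sigma> \<tau>)))"
      unfolding lin_def[of _ z]
    proof (rule sum.cong[OF refl])
      fix \<sigma> assume "\<sigma> \<in> supp z"
      then have "cube_set \<sigma> \<subseteq> X" "cdim \<sigma> = q" using sz by (auto simp: cubes_def)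
      then show "z \<sigma> * lin bd_cube (D \<sigma>) \<tau> = z \<sigma> * (lin D (bd_cube \<sigma>) \<tau> + s * (fcoef f \<sigma> \<tau> - fcoef g \<sigma> \<tau>))"
        using prism_identity[OF f g fg len, of \<sigma> \<tau>] by (simp add: D_def s_def)
    qed
    also have "\<dots> = lin (\<lambda>\<sigma>. lin D (bd_cube \<sigma>)) z \<tau> + s * (lin (fcoef f) z \<tau> - lin (fcoef g) z \<tau>)"
      unfolding lin_def[of _ z]
      by (simp add: distrib_left sum.distrib right_diff_distrib sum_subtractf sum_distrib_left mult.left_commute)
    also have "lin (\<lambda>\<sigma>. lin D (bd_cube \<sigma>)) z = lin D (lin bd_cube z)"
      by (rule lin_lin[symmetric, OF fz]) (rule finite_supp_bd_cube)
    finally have "lin bd_cube (lin D z) \<tau> = s * (lin (fcoef f) z \<tau> - lin (fcoef g) z \<tau>)"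
      by (simp add: z0)
    then have "lin bd_cube w \<tau> = lin (fcoef f) z \<tau> - lin (fcoef g) z \<tau>"
      unfolding w_def lin_scale[OF fDz] by (simp add: ss)
    then show "bd_chain n X (q + 1) w \<tau> = chain_map n X f q z \<tau> - chain_map n X g q z \<tau>"
      by (simp only: bd_chain_lin[OF X w] chain_map_lin[OF X zc])
  qed
  then show ?thesis unfolding bounds_def using w by (metis imageI)
qed

section \<open>The boundaries form a rational subspace\<close>

lemma lin_bd_in_bounds:
  assumes "finite X" "c \<in> chains n X (q + 1)"
  shows "lin bd_cube c \<in> bounds n X q"
  unfolding bounds_def bd_chain_lin[OF assms, symmetric] using assms(2) by (rule imageI)

lemma bounds_add:
  assumes X: "finite X" and "b \<in> bounds n X q" "b' \<in> bounds n X q"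
  shows "(\<lambda>t. b t + b' t) \<in> bounds n X q"
proof -
  obtain c c' where c: "c \<in> chains n X (q+1)" "b = lin bd_cube c" and c': "c' \<in> chains n X (q+1)" "b' = lin bd_cube c'"
    using assms bd_chain_lin[OF X] by (auto simp: bounds_def)
  have f: "finite (supp c)" "finite (supp c')"
    using c c' finite_subset[OF _ finite_cubes[OF X]] by (auto simp: chains_supp)
  have "supp (\<lambda>t. c t + c' t) \<subseteq> supp c \<union> supp c'" by (auto simp: supp_def)
  then have "(\<lambda>t. c t + c' t) \<in> chains n X (q+1)" using c(1) c'(1) unfolding chains_supp by blast
  moreover have "(\<lambda>t. b t + b' t) = lin bd_cube (\<lambda>t. c t + c' t)" unfolding c(2) c'(2) lin_add[OF f] ..
  ultimately show ?thesis using lin_bd_in_bounds[OF X] by metis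
qed

lemma bounds_scale:
  assumes X: "finite X" and "b \<in> bounds n X q"
  shows "(\<lambda>t. r * b t) \<in> bounds n X q"
proof -
  obtain c where c: "c \<in> chains n X (q+1)" "b = lin bd_cube c"
    using assms bd_chain_lin[OF X] by (auto simp: bounds_def)
  have f: "finite (supp c)"
    using c finite_subset[OF _ finite_cubes[OF X]] by (auto simp: chains_supp)
  have "(\<lambda>t. r * c t) \<in> chains n X (q+1)" using c by (auto simp: chains_def)
  moreover have "(\<lambda>t. r * b t) = lin bd_cube (\<lambda>t. r * c t)" unfolding c(2) lin_scale[OF f] ..
  ultimately show ?thesis using lin_bd_in_bounds[OF X] by metis
qed

lemma bounds_zero:
  assumes "finite X"
  shows "(\<lambda>_. 0) \<in> bounds n X q"
proof -
  have "(\<lambda>_. 0) \<in> chains n X (q+1)" by (simp add: chains_def)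
  from lin_bd_in_bounds[OF assms this] show ?thesis by simp
qed

section \<open>Traces on quotients\<close>

text \<open>Gaussian elimination: a vector that is nonzero at \<open>s\<close> serves as pivot to
  clear the coordinate \<open>s\<close> from the others, which leaves one vector and one coordinate
  fewer.\<close>

lemma nontrivial_relation:
  fixes u :: "'i \<Rightarrow> 'c \<Rightarrow> rat"
  assumes "finite S" "finite I" "card S < card I" "\<And>i. i \<in> I \<Longrightarrow> supp (u i) \<subseteq> S"
  shows "\<exists>a. (\<exists>i\<in>I. a i \<noteq> 0) \<and> (\<forall>t. (\<Sum>i\<in>I. a i * u i t) = 0)"
  using assms
proof (induction S arbitrary: I u rule: finite_induct)
  case empty
  then have "I \<noteq> {}" by auto
  moreover have "u i t = 0" if "i \<in> I" for i t using empty.prems(3)[OF that] by (auto simp: supp_def)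
  ultimately show ?case by (intro exI[of _ "\<lambda>_. 1"]) auto
next
  case (insert s S)
  show ?case
  proof (cases "\<forall>i\<in>I. u i s = 0")
    case True
    then have "supp (u i) \<subseteq> S" if "i \<in> I" for i using insert.prems(3)[OF that] that by (auto simp: supp_def)
    then show ?thesis using insert.prems insert.hyps by (intro insert.IH) auto
  next
    case False
    then obtain i0 where i0: "i0 \<in> I" "u i0 s \<noteq> 0" by blast
    define u' where "u' i t = u i t - u i s / u i0 s * u i0 t" for i t
    have "supp (u' i) \<subseteq> S" if "i \<in> I - {i0}" for i
    proof
      fix t assume t: "t \<in> supp (u' i)"
      have "t \<noteq> s" using t i0 by (auto simp: supp_def u'_def)
      moreover have "t \<in> insert s S"
      proof (rule ccontr)
        assume "t \<notin> insert s S"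
        then have "u i t = 0" "u i0 t = 0" using insert.prems(3) that i0(1) by (auto simp: supp_def)
        then show False using t by (simp add: supp_def u'_def)
      qed
      ultimately show "t \<in> S" by simp
    qed
    moreover have "card S < card (I - {i0})" using insert.prems insert.hyps i0 by simp
    ultimately obtain a where a: "\<exists>i\<in>I - {i0}. a i \<noteq> 0" "\<And>t. (\<Sum>i\<in>I - {i0}. a i * u' i t) = 0"
      using insert.IH[of "I - {i0}" u'] insert.prems by auto
    \<comment> \<open>The coefficient of the pivot collects what the elimination has subtracted from
      the other vectors.\<close>
    define b where "b i = (if i = i0 then - (\<Sum>j\<in>I - {i0}. a j * (u j s / u i0 s)) else a i)" for i
    have "(\<Sum>i\<in>I. b i * u i t) = 0" for t
    proof -
      have "(\<Sum>i\<in>I. b i * u i t) = b i0 * u i0 t + (\<Sum>i\<in>I - {i0}. a i * u i t)"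
        using insert.prems i0 by (subst sum.remove[of I i0]) (auto simp: b_def)
      also have "\<dots> = (\<Sum>i\<in>I - {i0}. a i * u' i t)"
        by (simp add: b_def u'_def right_diff_distrib sum_subtractf sum_distrib_right mult.assoc)
      finally show ?thesis using a by simp
    qed
    moreover have "\<exists>i\<in>I. b i \<noteq> 0" using a(1) by (auto simp: b_def)
    ultimately show ?thesis by blast
  qed
qed

text \<open>A longest list independent modulo \<open>B\<close> also spans: an element outside the
  span could be appended. A longest list exists because more than \<open>card S\<close> elements
  satisfy a nontrivial relation, whose value 0 lies in \<open>B\<close>. The choice in
  \<open>quot_trace\<close> is thereby meaningful.\<close>

lemma quot_basis_exists:
  fixes Z B :: "('c \<Rightarrow> rat) set"
  assumes S: "finite S" and Z: "\<And>z. z \<in> Z \<Longrightarrow> supp z \<subseteq> S"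
    and B0: "(\<lambda>_. 0) \<in> B" and Bs: "\<And>r b. b \<in> B \<Longrightarrow> (\<lambda>t. r * b t) \<in> B"
  shows "\<exists>zs. quot_basis Z B zs"
proof -
  define P where "P k \<longleftrightarrow> (\<exists>zs. length zs = k \<and> set zs \<subseteq> Z \<and>
    (\<forall>a. lincomb a zs \<in> B \<longrightarrow> (\<forall>i<length zs. a i = 0)))" for k
  have "P 0" by (auto simp: P_def)
  moreover have "k \<le> card S" if Pk: "P k" for k
  proof (rule ccontr)
    assume "\<not> k \<le> card S"
    then have card: "card S < card {..<k}" by simp
    obtain zs where zs: "length zs = k" "set zs \<subseteq> Z"
      "\<And>a. lincomb a zs \<in> B \<Longrightarrow> (\<forall>i<length zs. a i = 0)" using Pk unfolding P_def by blast
    have "supp (zs ! i) \<subseteq> S" if "i \<in> {..<k}" for i using that zs(1,2) by (intro Z) auto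
    from nontrivial_relation[OF S finite_lessThan card, of "\<lambda>i. zs ! i", OF this]
    obtain a where a: "\<exists>i\<in>{..<k}. a i \<noteq> 0" "\<forall>t. (\<Sum>i<k. a i * (zs ! i) t) = 0" by blast
    then have "lincomb a zs = (\<lambda>_. 0)" using zs(1) by (auto simp: lincomb_def)
    then show False using a(1) zs B0 by auto
  qed
  ultimately obtain k where k: "P k" "\<And>l. P l \<Longrightarrow> l \<le> k" using Nat.ex_has_greatest_nat[of P 0 "card S"] by blast
  then obtain zs where zs: "length zs = k" "set zs \<subseteq> Z"
      "\<And>a. lincomb a zs \<in> B \<Longrightarrow> (\<forall>i<length zs. a i = 0)" unfolding P_def by blast
  have "\<exists>a. (\<lambda>t. z t - lincomb a zs t) \<in> B" if z: "z \<in> Z" for z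
  proof (rule ccontr)
    assume no: "\<not> (\<exists>a. (\<lambda>t. z t - lincomb a zs t) \<in> B)"
    have snoc: "lincomb a (zs @ [z]) = (\<lambda>t. lincomb a zs t + a k * z t)" for a
      using zs(1) by (simp add: lincomb_def nth_append)
    have "\<forall>i<Suc k. a i = 0" if a: "lincomb a (zs @ [z]) \<in> B" for a
    proof (cases "a k = 0")
      case True
      then show ?thesis using a zs(1) zs(3)[of a] by (auto simp: snoc less_Suc_eq)
    next
      case False
      have "(\<lambda>t. (1 / a k) * (lincomb a zs t + a k * z t)) \<in> B" using a Bs unfolding snoc by blast
      moreover have "(\<lambda>t. (1 / a k) * (lincomb a zs t + a k * z t)) =
          (\<lambda>t. z t - lincomb (\<lambda>i. - a i / a k) zs t)"
        using False by (simp add: lincomb_def distrib_left sum_distrib_left sum_negf fun_eq_iff)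
      ultimately show ?thesis using no by auto
    qed
    then have "P (Suc k)" unfolding P_def using zs z by (intro exI[of _ "zs @ [z]"]) auto
    then show False using k(2)[of "Suc k"] by simp
  qed
  then show ?thesis using zs unfolding quot_basis_def by blast
qed

text \<open>The chosen basis depends on \<open>Z\<close> and \<open>B\<close> only. A coefficient
  vector is admissible for \<open>F z\<close> exactly when it is for \<open>G z\<close>, so the
  choice operator is applied to equal predicates and returns equal values.\<close>

lemma quot_trace_cong:
  assumes ex: "\<exists>zs. quot_basis Z B zs"
    and Ba: "\<And>b b'. b \<in> B \<Longrightarrow> b' \<in> B \<Longrightarrow> (\<lambda>t. b t + b' t) \<in> B"
    and Bs: "\<And>r b. b \<in> B \<Longrightarrow> (\<lambda>t. r * b t) \<in> B"
    and FG: "\<And>z. z \<in> Z \<Longrightarrow> (\<lambda>t. F z t - G z t) \<in> B"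
  shows "quot_trace Z B F = quot_trace Z B G"
proof -
  define zs where "zs = (SOME zs. quot_basis Z B zs)"
  have "quot_basis Z B zs" unfolding zs_def using ex by (rule someI_ex)
  then have "set zs \<subseteq> Z" by (simp add: quot_basis_def)
  then have Zi: "zs ! i \<in> Z" if "i < length zs" for i using that by auto
  have "(\<lambda>t. F z t - lincomb a zs t) \<in> B \<longleftrightarrow> (\<lambda>t. G z t - lincomb a zs t) \<in> B" if z: "z \<in> Z" for z a
  proof
    assume "(\<lambda>t. F z t - lincomb a zs t) \<in> B"
    from Ba[OF this Bs[OF FG[OF z], of "-1"]] show "(\<lambda>t. G z t - lincomb a zs t) \<in> B" by (simp add: algebra_simps)
  next
    assume "(\<lambda>t. G z t - lincomb a zs t) \<in> B"
    from Ba[OF this FG[OF z]] show "(\<lambda>t. F z t - lincomb a zs t) \<in> B" by (simp add: algebra_simps)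
  qed
  then show ?thesis
    unfolding quot_trace_def Let_def zs_def[symmetric] using Zi by (intro sum.cong refl) simp
qed

lemma htrace_eq_of_close:
  assumes X: "finite X" and "digi_cont X X f" "digi_cont X X g"
    and "\<And>x. x \<in> X \<Longrightarrow> f x = g x \<or> c1_adj (f x) (g x)"
    and "\<And>x. x \<in> X \<Longrightarrow> length x = n"
  shows "htrace n X f q = htrace n X g q"
  unfolding htrace_def
proof (rule quot_trace_cong)
  show "\<exists>zs. quot_basis (cycles n X q) (bounds n X q) zs"
    by (rule quot_basis_exists[OF finite_cubes[OF X, of n q]])
       (auto simp: cycles_def chains_supp bounds_zero[OF X] bounds_scale[OF X])
  show "(\<lambda>t. b t + b' t) \<in> bounds n X q" if "b \<in> bounds n X q" "b' \<in> bounds n X q" for b b'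
    using X that by (rule bounds_add)
  show "(\<lambda>t. r * b t) \<in> bounds n X q" if "b \<in> bounds n X q" for r b
    using X that by (rule bounds_scale)
  show "(\<lambda>t. chain_map n X f q z t - chain_map n X g q z t) \<in> bounds n X q" if "z \<in> cycles n X q" for z
    using assms that by (rule homotopic_chain_maps_differ_by_bound)
qed

theorem theorem4p2:
  fixes n :: nat and X :: "int list set" and f g :: "int list \<Rightarrow> int list"
  assumes "n \<le> 3"
    and "finite X"
    and "\<forall>p\<in>X. length p = n"
    and "digi_cont X X f"
    and "digi_cont X X g"
    and "digi_homotopic X X f g"
  shows "cub_lefschetz n X f = cub_lefschetz n X g"
proof -
  obtain m :: nat and H where H0: "\<forall>x\<in>X. H x 0 = f x \<and> H x m = g x"
    and Hc: "\<forall>t\<le>m. digi_cont X X (\<lambda>x. H x t)"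
    and Ht: "\<forall>x\<in>X. \<forall>t<m. H x t = H x (t + 1) \<or> c1_adj (H x t) (H x (t + 1))"
    using assms(6) unfolding digi_homotopic_def by blast
  note close = htrace_eq_of_close[OF assms(2), where n = n]
  have "htrace n X f q = htrace n X g q" for q
  proof -
    \<comment> \<open>Closeness of maps is not transitive, so the trace is carried along one time
      step after another.\<close>
    have "t \<le> m \<Longrightarrow> htrace n X (\<lambda>x. H x 0) q = htrace n X (\<lambda>x. H x t) q" for t
    proof (induction t)
      case (Suc t)
      have "htrace n X (\<lambda>x. H x t) q = htrace n X (\<lambda>x. H x (Suc t)) q"
        by (rule close) (use Hc Ht Suc.prems assms(3) in auto)
      then show ?case using Suc by simp
    qed simp
    from this[of m] have "htrace n X (\<lambda>x. H x 0) q = htrace n X (\<lambda>x. H x m) q" by simp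
    \<comment> \<open>The map \<open>f\<close> and the start of the homotopy agree on
      \<open>X\<close> only, and are therefore compared as a stationary homotopy step.\<close>
    moreover have "htrace n X f q = htrace n X (\<lambda>x. H x 0) q"
      by (rule close) (use Hc H0 assms in auto)
    moreover have "htrace n X (\<lambda>x. H x m) q = htrace n X g q"
      by (rule close) (use Hc H0 assms in auto)
    ultimately show ?thesis by simp
  qed
  then show ?thesis by (simp add: cub_lefschetz_def)
qed

end
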